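(* There exists an absolute constant $\epsilon>0$ such that for every $t$ with $\omega(\log n)\le t\le\epsilon n$, there exists an explicit family of polynomials $\{\mathcal{P}_{t,n}\}_n$ such that $\mathcal{P}_{t,n}$ is of degree $n$, has $N=n^2$ variables, and is computed by a $\mathrm{poly}(n)$ size homogeneous $\Sigma\Pi\Sigma\Pi^{[t]}$ circuit, and for every $t'$ such that $t'<t/20$, any homogeneous $\Sigma\Pi\Sigma\Pi^{[t']}$ circuit computing $\mathcal{P}_{t,n}$ must have top fan-in at least $$\exp\left(\Omega\left(\frac{n}{t}\log N\right)\right).$$
   Context: An arithmetic circuit over a field $\mathbb{F}$ is homogeneous if the polynomial computed at every node is homogeneous. A depth 4 ($\Sigma\Pi\Sigma\Pi$) circuit computes a polynomial in the form $P=\sum_{i=1}^{r}\prod_{j=1}^{d_i}Q_{i,j}$, where each $Q_{i,j}$ is computed as a sum of monomials ($\Sigma\Pi$ circuit). The number $r$ is its top fan-in. It is a $\Sigma\Pi\Sigma\Pi^{[a]}$ circuit if each $Q_{i,j}$ is a polynomial of degree at most $a$. The condition $\omega(\log n)\le t$ means that $t$ grows asymptotically faster than $\log n$. *)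

theory Defs
  imports Complex_Main "HOL-Library.Poly_Mapping" "HOL-Library.Landau_Symbols"
begin

section \<open>Multivariate polynomials\<close>

text \<open>
  Monomials are finitely supported exponent vectors over the variables \<open>x\<^sub>0, x\<^sub>1, \<dots>\<close>, and
  polynomials are finitely supported coefficient functions on monomials, with the convolution
  product of \<^theory>\<open>HOL-Library.Poly_Mapping\<close>.
\<close>

type_synonym monomial = "nat \<Rightarrow>\<^sub>0 nat"
type_synonym 'a mpoly = "monomial \<Rightarrow>\<^sub>0 'a"

definition mono_degree :: "monomial \<Rightarrow> nat" where
  "mono_degree m = (\<Sum>i\<in>Poly_Mapping.keys m. Poly_Mapping.lookup m i)"

text \<open>The zero polynomial gets total degree 0.\<close>

definition total_degree :: "'a::zero mpoly \<Rightarrow> nat" where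
  "total_degree p = Max (insert 0 (mono_degree ` Poly_Mapping.keys p))"

definition vars :: "'a::zero mpoly \<Rightarrow> nat set" where
  "vars p = (\<Union>m\<in>Poly_Mapping.keys p. Poly_Mapping.keys m)"

text \<open>The zero polynomial is homogeneous (of every degree).\<close>

definition homogeneous_poly :: "'a::zero mpoly \<Rightarrow> bool" where
  "homogeneous_poly p \<longleftrightarrow> (\<exists>d. \<forall>m\<in>Poly_Mapping.keys p. mono_degree m = d)"


section \<open>Arithmetic circuits\<close>

text \<open>
  Circuits are represented as trees with gates of unbounded fan-in. A constant-depth circuit
  with shared gates unfolds into such a tree with only a polynomial increase in size, and
  unfolding changes neither the polynomials computed at the gates nor the top fan-in.
\<close>

datatype 'a circuit =
    Input nat
  | Scalar 'a
  | Plus "'a circuit list"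
  | Times "'a circuit list"

fun computed :: "'a::comm_ring_1 circuit \<Rightarrow> 'a mpoly" where
  "computed (Input i) = Poly_Mapping.single (Poly_Mapping.single i 1) 1"
| "computed (Scalar c) = Poly_Mapping.single 0 c"
| "computed (Plus cs) = sum_list (map computed cs)"
| "computed (Times cs) = prod_list (map computed cs)"

fun nodes :: "'a circuit \<Rightarrow> 'a circuit set" where
  "nodes (Input i) = {Input i}"
| "nodes (Scalar c) = {Scalar c}"
| "nodes (Plus cs) = insert (Plus cs) (\<Union>c\<in>set cs. nodes c)"
| "nodes (Times cs) = insert (Times cs) (\<Union>c\<in>set cs. nodes c)"

definition homogeneous_circuit :: "'a::comm_ring_1 circuit \<Rightarrow> bool" where
  "homogeneous_circuit C \<longleftrightarrow> (\<forall>D\<in>nodes C. homogeneous_poly (computed D))"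

text \<open>The size of a circuit is its number of gates, the inputs included.\<close>

fun circuit_size :: "'a circuit \<Rightarrow> nat" where
  "circuit_size (Input i) = 1"
| "circuit_size (Scalar c) = 1"
| "circuit_size (Plus cs) = 1 + sum_list (map circuit_size cs)"
| "circuit_size (Times cs) = 1 + sum_list (map circuit_size cs)"

definition Sigma_over :: "'a circuit set \<Rightarrow> 'a circuit set" where
  "Sigma_over A = {Plus cs |cs. set cs \<subseteq> A}"

definition Pi_over :: "'a circuit set \<Rightarrow> 'a circuit set" where
  "Pi_over A = {Times cs |cs. set cs \<subseteq> A}"

definition leaves :: "'a circuit set" where
  "leaves = {Input i |i. True} \<union> {Scalar c |c. True}"

definition SigmaPi :: "'a circuit set" where
  "SigmaPi = Sigma_over (Pi_over leaves)"

definition SigmaPiSigmaPi :: "nat \<Rightarrow> 'a::comm_ring_1 circuit set" where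
  "SigmaPiSigmaPi a = Sigma_over (Pi_over {Q \<in> SigmaPi. total_degree (computed Q) \<le> a})"

text \<open>Used for circuits whose output gate is a sum; the value at other circuits is irrelevant.\<close>

fun top_fan_in :: "'a circuit \<Rightarrow> nat" where
  "top_fan_in (Plus cs) = length cs"
| "top_fan_in _ = 1"


section \<open>Explicit families\<close>

text \<open>
  The machine model is a random access machine with additions and (truncated) subtractions at
  unit cost. Each step increases the bit length of the largest number by at most one, so
  polynomial time on this machine is the usual polynomial time. The machine has registers and
  an indirectly addressed memory, all holding natural numbers; control flow is structured.
\<close>

datatype ram =
    Skip
  | Load_const nat nat        \<comment> \<open>\<open>r\<^sub>x := c\<close>\<close>
  | Add nat nat nat           \<comment> \<open>\<open>r\<^sub>x := r\<^sub>y + r\<^sub>z\<close>\<close>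
  | Sub nat nat nat           \<comment> \<open>\<open>r\<^sub>x := r\<^sub>y - r\<^sub>z\<close>\<close>
  | Load nat nat              \<comment> \<open>\<open>r\<^sub>x := mem[r\<^sub>y]\<close>\<close>
  | Store nat nat             \<comment> \<open>\<open>mem[r\<^sub>x] := r\<^sub>y\<close>\<close>
  | Seq ram ram
  | If_nonzero nat ram ram
  | While_nonzero nat ram

type_synonym ram_state = "(nat \<Rightarrow> nat) \<times> (nat \<Rightarrow> nat)"

text \<open>\<open>ram_exec c s k s'\<close>: started in state \<open>s\<close>, program \<open>c\<close> halts in state \<open>s'\<close> after \<open>k\<close> steps.\<close>

inductive ram_exec :: "ram \<Rightarrow> ram_state \<Rightarrow> nat \<Rightarrow> ram_state \<Rightarrow> bool" where
  "ram_exec Skip (r, mem) 1 (r, mem)"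
| "ram_exec (Load_const x c) (r, mem) 1 (r(x := c), mem)"
| "ram_exec (Add x y z) (r, mem) 1 (r(x := r y + r z), mem)"
| "ram_exec (Sub x y z) (r, mem) 1 (r(x := r y - r z), mem)"
| "ram_exec (Load x y) (r, mem) 1 (r(x := mem (r y)), mem)"
| "ram_exec (Store x y) (r, mem) 1 (r, mem(r x := r y))"
| "ram_exec c s k s' \<Longrightarrow> ram_exec d s' l s'' \<Longrightarrow> ram_exec (Seq c d) s (k + l) s''"
| "r x \<noteq> 0 \<Longrightarrow> ram_exec c (r, mem) k s' \<Longrightarrow> ram_exec (If_nonzero x c d) (r, mem) (k + 1) s'"
| "r x = 0 \<Longrightarrow> ram_exec d (r, mem) k s' \<Longrightarrow> ram_exec (If_nonzero x c d) (r, mem) (k + 1) s'"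
| "r x = 0 \<Longrightarrow> ram_exec (While_nonzero x c) (r, mem) 1 (r, mem)"
| "r x \<noteq> 0 \<Longrightarrow> ram_exec c (r, mem) k s' \<Longrightarrow> ram_exec (While_nonzero x c) s' l s'' \<Longrightarrow>
     ram_exec (While_nonzero x c) (r, mem) (k + l + 1) s''"

text \<open>
  The input consists of \<open>n\<close>, the parameter \<open>t\<close>, and the exponent vector of a monomial; the
  output is left in register 0.
\<close>

definition ram_input :: "nat \<Rightarrow> nat \<Rightarrow> monomial \<Rightarrow> ram_state" where
  "ram_input n t m = ((\<lambda>_. 0)(0 := n, 1 := t), Poly_Mapping.lookup m)"

text \<open>
  A family \<open>P\<^sub>n\<close> in \<open>n\<^sup>2\<close> variables, with side parameter \<open>t(n)\<close>, is explicit if one program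
  computes the coefficient of any given monomial in time polynomial in \<open>n\<close> and the degree of the
  monomial. Coefficients are natural numbers, read in the field. Since \<open>t\<close> is an arbitrary
  function, possibly not computable, its value is part of the input.
\<close>

definition explicit_family :: "(nat \<Rightarrow> nat) \<Rightarrow> (nat \<Rightarrow> 'a::comm_ring_1 mpoly) \<Rightarrow> bool" where
  "explicit_family t P \<longleftrightarrow>
     (\<exists>prog d. \<forall>n m. Poly_Mapping.keys m \<subseteq> {..<n\<^sup>2} \<longrightarrow>
        (\<exists>k r mem. ram_exec prog (ram_input n (t n) m) k (r, mem) \<and>
           k \<le> (n + mono_degree m + 2) ^ d \<and> Poly_Mapping.lookup (P n) m = of_nat (r 0)))"

end

theory Submission
  imports Defs "HOL-Library.FuncSet"
begin

text \<open>
  The family is a product of sums of variable-disjoint monomials: the variables form an \<open>n \<times> n\<close>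
  matrix whose rows are split into bands of height \<open>t\<close>, and
  \<open>P = \<Prod>\<^sub>i \<Sum>\<^sub>a \<Prod>\<^sub>\<rho> x\<^sub>\<rho>\<^sub>,\<^sub>a\<close> with \<open>i\<close> over the bands, \<open>a\<close> over the columns and \<open>\<rho>\<close> over
  the rows of band \<open>i\<close>. One derivative per band isolates a single monomial, and monomials for
  choices of columns differing in \<open>j\<close> bands are about \<open>j (t - 1)\<close> apart, so the shifts of these
  derivatives span a large space. After merging factors, a product of polynomials of degree at most
  \<open>s = t div 20\<close> has \<open>O(n / s)\<close> factors of degree at most \<open>2 s\<close>, and its shifted \<open>k\<close>-th
  derivatives are combinations of multiples of the products omitting at most \<open>k\<close> factors. The
  dimensions are compared by their generating functions at a point \<open>z\<close> with \<open>z ^ (t - 1) = 1 / n ^ 3\<close>.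
\<close>

text \<open>Two counts compete. There are about n^(n/t) choices of columns. Each product of factors
  yields one family of generators per omitted set of factors, and omitting k factors of degree up to
  2 s enlarges a family by up to z^(-2 s k), where k is the number of bands, about n/t. A small z
  makes the isolated monomials almost independent: their overlaps sum to at most (1 + n z^(t-1))^k -
  1, which n^(-3) brings below 1/2. A z that is too small makes the omitted factors too expensive;
  here 2 s is at most t/10, so they cost only about n^(n/(3 t)). The gap of 20 between t and t' pays
  for this. Merging is forced by the number of omitted sets. A product may have n linear factors,
  and 2^n sets would swamp n^(n/t) once t exceeds log n. After merging there are 2^O(n/t) sets,
  which a large log n absorbs. Only squarefree monomials are differentiated to isolate a term, so
  the coefficients that arise are 0 or 1 and the field may have any characteristic.\<close>

abbreviation "lookup \<equiv> Poly_Mapping.lookup"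
abbreviation "keys \<equiv> Poly_Mapping.keys"
abbreviation "single \<equiv> Poly_Mapping.single"

section \<open>Monomials\<close>

lemma mono_degree_eq_sum:
  assumes "finite A" "keys m \<subseteq> A"
  shows "mono_degree m = (\<Sum>i\<in>A. lookup m i)"
  unfolding mono_degree_def
  by (rule sum.mono_neutral_left) (use assms in \<open>auto simp: in_keys_iff\<close>)

lemma mono_degree_zero [simp]: "mono_degree 0 = 0"
  by (simp add: mono_degree_def)

lemma keys_add_nat: "keys (a + b :: monomial) = keys a \<union> keys b"
  by (auto simp: in_keys_iff lookup_add)

lemma mono_degree_add [simp]: "mono_degree (a + b) = mono_degree a + mono_degree b"
proof -
  let ?A = "keys a \<union> keys b"
  have "mono_degree (a + b) = (\<Sum>i\<in>?A. lookup (a + b) i)"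
    by (rule mono_degree_eq_sum) (auto simp: keys_add_nat)
  also have "\<dots> = (\<Sum>i\<in>?A. lookup a i) + (\<Sum>i\<in>?A. lookup b i)"
    by (simp add: lookup_add sum.distrib)
  finally show ?thesis
    by (simp add: mono_degree_eq_sum[of ?A a] mono_degree_eq_sum[of ?A b])
qed

lemma mono_degree_single [simp]: "mono_degree (single v c) = c"
  by (cases "c = 0") (auto simp: mono_degree_def)

lemma monomial_diff_add:
  fixes a u :: monomial
  assumes "\<And>v. lookup a v \<le> lookup u v"
  shows "(u - a) + a = u"
  by (rule poly_mapping_eqI) (use assms in \<open>simp add: lookup_add lookup_minus\<close>)

definition mons :: "nat set \<Rightarrow> nat \<Rightarrow> monomial set" where
  "mons V d = {m. keys m \<subseteq> V \<and> mono_degree m = d}"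

lemma mons_add: "a \<in> mons V d \<Longrightarrow> b \<in> mons V e \<Longrightarrow> a + b \<in> mons V (d + e)"
  by (auto simp: mons_def keys_add_nat)

lemma lookup_le_mono_degree: "lookup m i \<le> mono_degree m"
  by (cases "i \<in> keys m") (auto simp: mono_degree_def in_keys_iff intro: member_le_sum)

text \<open>A monomial is determined by its exponents on \<open>V\<close>, each at most
  \<open>d\<close>. The crude bound suffices because only polynomial growth in \<open>d\<close> is
  needed, for convergence of the Hilbert series at every z < 1.\<close>

lemma
  assumes "finite V"
  shows finite_mons: "finite (mons V d)"
    and card_mons_le: "card (mons V d) \<le> Suc d ^ card V"
proof -
  let ?f = "\<lambda>m::monomial. restrict (lookup m) V"
  have inj: "inj_on ?f (mons V d)"
  proof (rule inj_onI, rule poly_mapping_eqI)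
    fix a b :: monomial and k
    assume a: "a \<in> mons V d" "b \<in> mons V d" "?f a = ?f b"
    show "lookup a k = lookup b k"
    proof (cases "k \<in> V")
      case True
      then show ?thesis using a(3) by (metis restrict_apply')
    next
      case False
      then have "k \<notin> keys a" "k \<notin> keys b" using a by (auto simp: mons_def)
      then show ?thesis by (simp add: in_keys_iff)
    qed
  qed
  have sub: "?f ` mons V d \<subseteq> V \<rightarrow>\<^sub>E {..d}"
    using lookup_le_mono_degree by (fastforce simp: mons_def)
  have fin: "finite (V \<rightarrow>\<^sub>E {..d})"
    by (simp add: assms finite_PiE)
  show "finite (mons V d)"
    using finite_imageD[OF finite_subset[OF sub fin] inj] .
  have "card (mons V d) = card (?f ` mons V d)"
    by (simp add: card_image inj)
  also have "\<dots> \<le> card (V \<rightarrow>\<^sub>E {..d})"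
    by (rule card_mono[OF fin sub])
  finally show "card (mons V d) \<le> Suc d ^ card V"
    by (simp add: card_PiE assms)
qed

lemma card_mons_multiple:
  assumes "finite V" "keys g \<subseteq> V"
  shows "card {u \<in> mons V d. \<forall>v. lookup g v \<le> lookup u v} =
         (if mono_degree g \<le> d then card (mons V (d - mono_degree g)) else 0)"
proof -
  let ?L = "{u \<in> mons V d. \<forall>v. lookup g v \<le> lookup u v}"
  show ?thesis
  proof (cases "mono_degree g \<le> d")
    case True
    have "bij_betw (\<lambda>w. w + g) (mons V (d - mono_degree g)) ?L"
    proof (rule bij_betwI')
      fix u assume u: "u \<in> ?L"
      then have e: "(u - g) + g = u" by (intro monomial_diff_add) auto
      have "keys (u - g) \<subseteq> V"
        using u by (auto simp: mons_def in_keys_iff lookup_minus subset_iff)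
      moreover have "mono_degree (u - g) = d - mono_degree g"
        using u mono_degree_add[of "u - g" g] by (simp add: e mons_def)
      ultimately show "\<exists>w\<in>mons V (d - mono_degree g). u = w + g"
        using e by (intro bexI[of _ "u - g"]) (auto simp: mons_def)
    qed (use True assms(2) in \<open>auto simp: mons_def lookup_add keys_add_nat\<close>)
    then show ?thesis using True by (simp add: bij_betw_same_card)
  next
    case False
    have "?L = {}"
    proof (rule ccontr)
      assume "?L \<noteq> {}"
      then obtain u where u: "u \<in> ?L" by blast
      then have "(u - g) + g = u" by (intro monomial_diff_add) auto
      then have "mono_degree u \<ge> mono_degree g"
        by (metis le_add2 mono_degree_add)
      then show False using u False by (simp add: mons_def)
    qed
    then show ?thesis using False by (simp only: card.empty if_False)
  qed
qed

definition sqfree :: "nat set \<Rightarrow> monomial" where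
  "sqfree S = (\<Sum>v\<in>S. single v 1)"

lemma lookup_sqfree: "finite S \<Longrightarrow> lookup (sqfree S) v = (if v \<in> S then 1 else 0)"
  by (simp add: sqfree_def lookup_sum lookup_single when_def)

lemma keys_sqfree [simp]: "finite S \<Longrightarrow> keys (sqfree S) = S"
  by (auto simp: in_keys_iff lookup_sqfree split: if_splits)

lemma mono_degree_sqfree [simp]: "finite S \<Longrightarrow> mono_degree (sqfree S) = card S"
  by (simp add: mono_degree_def lookup_sqfree)


section \<open>Polynomials as a vector space\<close>

text \<open>Scalars act as constant polynomials, so the vector space laws are ring laws, and the
  bound on independent sets inside a span becomes available for the dimension count.\<close>

interpretation mpoly: vector_space "\<lambda>(c::'a::field) (p::'a mpoly). single 0 c * p"
proof
  fix a b :: 'a and x y :: "'a mpoly"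
  show "single 0 a * (x + y) = single 0 a * x + single 0 a * y" by (rule distrib_left)
  show "single 0 (a + b) * x = single 0 a * x + single 0 b * x"
    by (simp add: single_add distrib_right)
  show "single 0 a * (single 0 b * x) = single 0 (a * b) * x"
    by (simp add: mult.assoc[symmetric] mult_single)
  show "single 0 1 * x = x" by simp
qed

lemma lookup_scale: "lookup (single 0 c * p) m = (c::'a::field) * lookup p m"
proof -
  have "single 0 c * p = Poly_Mapping.map ((*) c) p"
    by (simp add: mult_map_scale_conv_mult)
  then show ?thesis by (simp add: Poly_Mapping.map.rep_eq when_def)
qed

lemma poly_sum_singles: "(p::'a::field mpoly) = (\<Sum>m\<in>keys p. single m (lookup p m))"
  by (rule poly_mapping_eqI) (auto simp: lookup_sum lookup_single when_def in_keys_iff)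

lemma poly_in_span_singles: "(p::'a::field mpoly) \<in> mpoly.span ((\<lambda>m. single m 1) ` keys p)"
proof -
  have "(\<Sum>m\<in>keys p. single m (lookup p m)) \<in> mpoly.span ((\<lambda>m. single m 1) ` keys p)"
  proof (rule mpoly.span_sum)
    fix m assume "m \<in> keys p"
    then have "single 0 (lookup p m) * single m 1 \<in> mpoly.span ((\<lambda>m. single m 1) ` keys p)"
      by (intro mpoly.span_scale mpoly.span_base) auto
    then show "single m (lookup p m) \<in> mpoly.span ((\<lambda>m. single m 1) ` keys p)"
      by (simp add: mult_single)
  qed
  then show ?thesis using poly_sum_singles[of p] by metis
qed

text \<open>The polynomials whose coefficient at \<open>u\<close> vanishes form a subspace that
  contains every other monomial but not \<open>u\<close>.\<close>

lemma independent_singles: "mpoly.independent ((\<lambda>m. single m (1::'a::field)) ` U)"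
proof
  assume "mpoly.dependent ((\<lambda>m. single m (1::'a)) ` U)"
  then obtain u where u: "u \<in> U" and
    "single u (1::'a) \<in> mpoly.span ((\<lambda>m. single m 1) ` U - {single u 1})"
    unfolding mpoly.dependent_def by auto
  moreover have "mpoly.subspace {p::'a mpoly. lookup p u = 0}"
    by (auto simp: mpoly.subspace_def lookup_add lookup_scale)
  moreover have "(\<lambda>m. single m 1) ` U - {single u 1} \<subseteq> {p::'a mpoly. lookup p u = 0}"
    by (auto simp: lookup_single when_def)
  ultimately have "single u (1::'a) \<in> {p. lookup p u = 0}"
    using mpoly.span_minimal by blast
  then show False by simp
qed

lemma span_mult_left_mem:
  fixes p q :: "'a::field mpoly"
  assumes "q \<in> mpoly.span G" "\<And>g. g \<in> G \<Longrightarrow> p * g \<in> mpoly.span F"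
  shows "p * q \<in> mpoly.span F"
  using assms(1)
proof (rule mpoly.span_induct)
  show "mpoly.subspace {q. p * q \<in> mpoly.span F}"
  proof (rule mpoly.subspaceI)
    fix c x assume "x \<in> {q. p * q \<in> mpoly.span F}"
    then show "single 0 c * x \<in> {q. p * q \<in> mpoly.span F}"
      using mpoly.span_scale[of "p * x" F c] by (simp add: mult.left_commute)
  qed (simp_all add: distrib_left mpoly.span_zero mpoly.span_add)
qed (use assms(2) in auto)


section \<open>Partial derivatives\<close>

text \<open>The monomial \<open>m\<close> of a derivative can only come from
  \<open>m + single v 1\<close>. Adding an exponent is injective, so the support stays
  finite.\<close>

lift_definition pd :: "nat \<Rightarrow> 'a::field mpoly \<Rightarrow> 'a mpoly" is
  "\<lambda>v p m. of_nat (lookup m v + 1) * p (m + single v 1)"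
proof -
  fix v and p :: "monomial \<Rightarrow> 'a"
  assume f: "finite {m. p m \<noteq> 0}"
  have "finite ((\<lambda>m. m + single v 1) -` {m. p m \<noteq> 0})"
    by (rule finite_vimageI[OF f]) (simp add: inj_def)
  then show "finite {m. of_nat (lookup m v + 1) * p (m + single v 1) \<noteq> 0}"
    by (rule rev_finite_subset) auto
qed

lemma lookup_pd: "lookup (pd v p) m = of_nat (lookup m v + 1) * lookup p (m + single v 1)"
  by transfer simp

lemma pd_0 [simp]: "pd v 0 = 0"
  by (rule poly_mapping_eqI) (simp add: lookup_pd)

lemma pd_add: "pd v (p + q) = pd v p + pd v q"
  by (rule poly_mapping_eqI) (simp add: lookup_pd lookup_add ring_distribs)

lemma pd_scale: "pd v (single 0 c * p) = single 0 c * pd v p"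
  by (rule poly_mapping_eqI) (simp add: lookup_pd lookup_scale)

lemma pd_sum: "pd v (sum f A) = (\<Sum>x\<in>A. pd v (f x))"
  by (induction A rule: infinite_finite_induct) (simp_all add: pd_add)

lemma pd_single: "pd v (single m c) = single (m - single v 1) (of_nat (lookup m v) * c)"
proof (rule poly_mapping_eqI)
  fix k
  show "lookup (pd v (single m c)) k = lookup (single (m - single v 1) (of_nat (lookup m v) * c)) k"
  proof (cases "lookup m v = 0")
    case True
    then have "k + single v 1 \<noteq> m" by (auto simp: lookup_add)
    then show ?thesis using True by (simp add: lookup_pd lookup_single when_def)
  next
    case False
    have "k + single v 1 = m \<longleftrightarrow> k = m - single v 1"
    proof
      assume k: "k = m - single v 1"
      show "k + single v 1 = m"
        unfolding k by (rule monomial_diff_add) (use False in \<open>auto simp: lookup_single when_def\<close>)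
    qed auto
    moreover have "k = m - single v 1 \<Longrightarrow> lookup k v + 1 = lookup m v"
      using False by (simp add: lookup_minus)
    ultimately show ?thesis
      unfolding lookup_pd lookup_single when_def by (cases "k = m - single v 1") simp_all
  qed
qed

lemma pd_single_mult_single:
  "pd v (single a c * single b d) = pd v (single a c) * single b d + single a c * pd v (single b d)"
proof -
  \<comment> \<open>If \<open>v\<close> does not occur in \<open>x\<close>, the truncated
    differences can be different monomials, but then the coefficient is 0 on both sides.\<close>
  have *: "single (x + y - single v 1) (of_nat (lookup x v) * k) =
    single ((x - single v 1) + y) (of_nat (lookup x v) * k)" for x y :: monomial and k :: 'a
  proof (cases "lookup x v = 0")
    case False
    have "x + y - single v 1 = (x - single v 1) + y"
      by (rule poly_mapping_eqI) (use False in \<open>auto simp: lookup_add lookup_minus lookup_single when_def\<close>)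
    then show ?thesis by simp
  qed simp
  have "pd v (single a c * single b d) =
    single (a + b - single v 1) (of_nat (lookup a v) * (c * d)) +
    single (a + b - single v 1) (of_nat (lookup b v) * (c * d))"
    by (simp add: mult_single pd_single lookup_add single_add[symmetric] ring_distribs)
  also have "\<dots> = single ((a - single v 1) + b) (of_nat (lookup a v) * (c * d)) +
    single (a + (b - single v 1)) (of_nat (lookup b v) * (c * d))"
    using *[of a b "c * d"] *[of b a "c * d"] by (simp add: add.commute)
  finally show ?thesis
    by (simp add: mult_single pd_single ac_simps)
qed

lemma pd_mult: "pd v (p * q) = pd v p * q + p * pd v q"
proof -
  define f where "f m = single m (lookup p m)" for m
  define g where "g m = single m (lookup q m)" for m
  have p: "p = sum f (keys p)" and q: "q = sum g (keys q)"
    unfolding f_def g_def by (rule poly_sum_singles)+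
  have fg: "pd v (f a * g b) = pd v (f a) * g b + f a * pd v (g b)" for a b
    by (simp add: f_def g_def pd_single_mult_single)
  have "pd v (sum f A * sum g B) = pd v (sum f A) * sum g B + sum f A * pd v (sum g B)" for A B
    by (simp add: sum_product pd_sum fg sum.distrib)
  from this[of "keys p" "keys q"] show ?thesis by (simp flip: p q)
qed

lemma pd_1 [simp]: "pd v 1 = 0"
  using pd_single[of v 0 1] by simp

lemma pd_prod:
  "finite J \<Longrightarrow> pd v (\<Prod>j\<in>J. R j) = (\<Sum>j\<in>J. pd v (R j) * (\<Prod>i\<in>J - {j}. R i))"
proof (induction J rule: finite_induct)
  case (insert x J)
  have "(\<Prod>i\<in>insert x J - {j}. R i) = R x * (\<Prod>i\<in>J - {j}. R i)" if "j \<in> J" for j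
  proof -
    have "insert x J - {j} = insert x (J - {j})" using that insert by auto
    then show ?thesis using insert by simp
  qed
  then have "(\<Sum>j\<in>J. pd v (R j) * (\<Prod>i\<in>insert x J - {j}. R i)) =
             R x * (\<Sum>j\<in>J. pd v (R j) * (\<Prod>i\<in>J - {j}. R i))"
    by (simp add: sum_distrib_left mult_ac)
  then show ?case using insert by (simp add: pd_mult)
qed simp

text \<open>The converse can fail in positive characteristic, where \<open>of_nat\<close> may
  vanish. This direction is enough to control degrees and variables.\<close>

lemma keys_pd: "m \<in> keys (pd v p) \<Longrightarrow> m + single v 1 \<in> keys p"
  by (auto simp: in_keys_iff lookup_pd)

lemma pd_span_mem:
  fixes q :: "'a::field mpoly"
  assumes "q \<in> mpoly.span G" "\<And>g. g \<in> G \<Longrightarrow> pd v g \<in> mpoly.span F"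
  shows "pd v q \<in> mpoly.span F"
  using assms(1)
proof (rule mpoly.span_induct)
  show "mpoly.subspace {q. pd v q \<in> mpoly.span F}"
    by (rule mpoly.subspaceI)
      (auto simp: pd_add pd_scale mpoly.span_zero intro: mpoly.span_add mpoly.span_scale)
qed (use assms(2) in auto)

abbreviation pds :: "nat list \<Rightarrow> 'a::field mpoly \<Rightarrow> 'a mpoly" where
  "pds vs p \<equiv> foldr pd vs p"

lemma pds_0 [simp]: "pds vs 0 = 0"
  by (induction vs) auto

lemma pds_sum: "pds vs (sum f A) = (\<Sum>x\<in>A. pds vs (f x))"
  by (induction vs) (auto simp: pd_sum)

lemma pd_sqfree:
  assumes "finite S"
  shows "pd v (single (sqfree S) c) = (if v \<in> S then single (sqfree (S - {v})) c else 0)"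
proof (cases "v \<in> S")
  case True
  have "sqfree S - single v 1 = sqfree (S - {v})"
    by (rule poly_mapping_eqI)
      (use assms True in \<open>auto simp: lookup_minus lookup_sqfree lookup_single when_def\<close>)
  then show ?thesis using assms True by (simp add: pd_single lookup_sqfree)
qed (use assms in \<open>simp add: pd_single lookup_sqfree\<close>)

text \<open>Exponents are at most 1, so each derivative has factor 0 or 1 in any characteristic.
  Distinctness matters: a repeated variable would give 0.\<close>

lemma pds_sqfree:
  assumes "finite S" "distinct vs"
  shows "pds vs (single (sqfree S) c) = (if set vs \<subseteq> S then single (sqfree (S - set vs)) c else 0)"
  using assms(2)
proof (induction vs)
  case (Cons v vs)
  have "S - set vs - {v} = S - insert v (set vs)" by auto
  then show ?case using Cons assms(1) by (auto simp: pd_sqfree)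
qed simp


section \<open>Shifted partial derivatives\<close>

text \<open>A space containing all shifted derivatives of order at most \<open>k\<close> of the
  product over \<open>J\<close>: \<open>S\<close> is the set of factors touched so far, whose
  remains are absorbed into \<open>u\<close>. The degree of \<open>R j\<close> is recorded by
  \<open>e j\<close>, so zero factors need no special treatment.\<close>

definition shifted_gens ::
    "nat set \<Rightarrow> 'i set \<Rightarrow> ('i \<Rightarrow> 'a::field mpoly) \<Rightarrow> ('i \<Rightarrow> nat) \<Rightarrow> nat \<Rightarrow> nat \<Rightarrow> 'a mpoly set" where
  "shifted_gens V J R e k d =
    {single u 1 * (\<Prod>j\<in>J - S. R j) | u S.
       S \<subseteq> J \<and> card S \<le> k \<and> keys u \<subseteq> V \<and> mono_degree u + (\<Sum>j\<in>J - S. e j) = d}"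

text \<open>By the Leibniz rule the derivative falls either on \<open>u\<close>, leaving
  \<open>S\<close> alone, or on some untouched \<open>R j\<close>. In the second case the derivative
  of \<open>R j\<close> is expanded into monomials, which are merged into \<open>u\<close>, and
  \<open>j\<close> joins \<open>S\<close>.\<close>

lemma pd_shifted_gens:
  fixes R :: "'i \<Rightarrow> 'a::field mpoly"
  assumes J: "finite J" and R: "\<And>j. j \<in> J \<Longrightarrow> keys (R j) \<subseteq> mons V (e j)"
    and g: "g \<in> shifted_gens V J R e k (Suc d)"
  shows "pd v g \<in> mpoly.span (shifted_gens V J R e (Suc k) d)"
proof -
  let ?G = "shifted_gens V J R e (Suc k) d"
  from g obtain u S where S: "S \<subseteq> J" "card S \<le> k" and u: "keys u \<subseteq> V"
    and deg: "mono_degree u + (\<Sum>j\<in>J - S. e j) = Suc d"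
    and g_eq: "g = single u 1 * (\<Prod>j\<in>J - S. R j)"
    unfolding shifted_gens_def by blast
  have finS: "finite S" using S J finite_subset by blast
  have "pd v (single u 1) * (\<Prod>j\<in>J - S. R j) \<in> mpoly.span ?G"
  proof (cases "lookup u v = 0")
    case True
    then show ?thesis by (simp add: pd_single mpoly.span_zero)
  next
    case False
    have e: "(u - single v 1) + single v 1 = u"
      by (rule monomial_diff_add) (use False in \<open>auto simp: lookup_single when_def\<close>)
    have "mono_degree (u - single v 1) + 1 = mono_degree u"
      by (metis e mono_degree_add mono_degree_single)
    then have "mono_degree (u - single v 1) + (\<Sum>j\<in>J - S. e j) = d" using deg by simp
    moreover have "keys (u - single v 1) \<subseteq> V"
      using u by (auto simp: in_keys_iff lookup_minus subset_iff)
    ultimately have "single (u - single v 1) 1 * (\<Prod>j\<in>J - S. R j) \<in> ?G"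
      unfolding shifted_gens_def using S by fastforce
    then have "single 0 (of_nat (lookup u v)) * (single (u - single v 1) 1 * (\<Prod>j\<in>J - S. R j))
      \<in> mpoly.span ?G"
      by (intro mpoly.span_scale mpoly.span_base)
    then show ?thesis
      by (simp add: pd_single mult.assoc[symmetric] mult_single del: single_of_nat)
  qed
  moreover have "single u 1 * (pd v (R j) * (\<Prod>i\<in>J - S - {j}. R i)) \<in> mpoly.span ?G"
    if j: "j \<in> J - S" for j
  proof -
    have "(single u 1 * (\<Prod>i\<in>J - S - {j}. R i)) * pd v (R j) \<in> mpoly.span ?G"
    proof (rule span_mult_left_mem[OF poly_in_span_singles])
      fix h assume "h \<in> (\<lambda>m. single m (1::'a)) ` keys (pd v (R j))"
      then obtain m where m: "m \<in> keys (pd v (R j))" and h: "h = single m 1" by blast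
      have "m + single v 1 \<in> mons V (e j)" using keys_pd[OF m] R j by blast
      then have m': "keys m \<subseteq> V" "mono_degree m + 1 = e j"
        by (auto simp: mons_def keys_add_nat)
      have JS: "J - insert j S = J - S - {j}" by blast
      have "mono_degree (u + m) + (\<Sum>i\<in>J - insert j S. e i) = d"
      proof -
        have "(\<Sum>i\<in>J - S. e i) = e j + (\<Sum>i\<in>J - S - {j}. e i)"
          by (rule sum.remove) (use J j in auto)
        then show ?thesis using deg m'(2) unfolding JS by simp
      qed
      moreover have "card (insert j S) \<le> Suc k"
        using S(2) finS j by simp
      moreover have "keys (u + m) \<subseteq> V" using u m' by (simp add: keys_add_nat)
      ultimately have "single (u + m) 1 * (\<Prod>i\<in>J - insert j S. R i) \<in> ?G"
        unfolding shifted_gens_def using S j by blast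
      moreover have "single u 1 * (\<Prod>i\<in>J - S - {j}. R i) * h =
        single (u + m) 1 * (\<Prod>i\<in>J - insert j S. R i)"
      proof -
        have "single u 1 * (\<Prod>i\<in>J - S - {j}. R i) * h =
              (single u 1 * single m 1) * (\<Prod>i\<in>J - S - {j}. R i)"
          by (simp only: h mult_ac)
        then show ?thesis unfolding JS by (simp add: mult_single)
      qed
      ultimately show "single u 1 * (\<Prod>i\<in>J - S - {j}. R i) * h \<in> mpoly.span ?G"
        by (simp add: mpoly.span_base)
    qed
    then show ?thesis by (simp add: mult_ac)
  qed
  then have "(\<Sum>j\<in>J - S. single u 1 * (pd v (R j) * (\<Prod>i\<in>J - S - {j}. R i))) \<in> mpoly.span ?G"
    by (rule mpoly.span_sum)
  ultimately show ?thesis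
    using J by (simp add: g_eq pd_mult pd_prod sum_distrib_left mpoly.span_add)
qed

lemma pds_shifted_gens:
  assumes J: "finite J" and R: "\<And>j. j \<in> J \<Longrightarrow> keys (R j) \<subseteq> mons V (e j)"
    and g: "g \<in> mpoly.span (shifted_gens V J R e k (d + length vs))"
  shows "pds vs g \<in> mpoly.span (shifted_gens V J R e (k + length vs) d)"
  using g
proof (induction vs arbitrary: d)
  case (Cons v vs)
  have "pds vs g \<in> mpoly.span (shifted_gens V J R e (k + length vs) (Suc d))"
    by (rule Cons.IH) (use Cons.prems in simp)
  then show ?case
    using pd_span_mem[OF _ pd_shifted_gens[OF J R]] by simp
qed simp

lemma shift_shifted_gens:
  assumes w: "keys w \<subseteq> V" and g: "g \<in> mpoly.span (shifted_gens V J R e k d)"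
  shows "single w 1 * g \<in> mpoly.span (shifted_gens V J R e k (mono_degree w + d))"
  using g
proof (rule span_mult_left_mem)
  fix g assume "g \<in> shifted_gens V J R e k d"
  then obtain u S where *: "S \<subseteq> J" "card S \<le> k" "keys u \<subseteq> V"
    "mono_degree u + (\<Sum>j\<in>J - S. e j) = d" "g = single u 1 * (\<Prod>j\<in>J - S. R j)"
    unfolding shifted_gens_def by blast
  have "single w 1 * g = single (w + u) 1 * (\<Prod>j\<in>J - S. R j)"
    by (simp add: * mult.assoc[symmetric] mult_single)
  moreover have "mono_degree (w + u) + (\<Sum>j\<in>J - S. e j) = mono_degree w + d"
    "keys (w + u) \<subseteq> V"
    using * w by (auto simp: keys_add_nat)
  ultimately have "single w 1 * g \<in> shifted_gens V J R e k (mono_degree w + d)"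
    unfolding shifted_gens_def using * by blast
  then show "single w 1 * g \<in> mpoly.span (shifted_gens V J R e k (mono_degree w + d))"
    by (rule mpoly.span_base)
qed

section \<open>Counting generators and multiples through Hilbert series\<close>

text \<open>The Hilbert function of a principal monomial ideal with generator of degree \<open>c\<close>.\<close>

definition hilb :: "nat set \<Rightarrow> nat \<Rightarrow> nat \<Rightarrow> nat" where
  "hilb V c d = (if c \<le> d then card (mons V (d - c)) else 0)"

text \<open>For a fixed omitted set the generators are indexed by \<open>u\<close>, whose degree is
  forced. Different sets may give equal generators, hence only an upper bound.\<close>

lemma shifted_gens_card:
  assumes V: "finite V" and J: "finite J"
  shows "finite (shifted_gens V J R e k d)"
    and "card (shifted_gens V J R e k d) \<le>
           (\<Sum>S | S \<subseteq> J \<and> card S \<le> k. hilb V (\<Sum>j\<in>J - S. e j) d)"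
proof -
  let ?c = "\<lambda>S. \<Sum>j\<in>J - S. e j"
  let ?Ss = "{S. S \<subseteq> J \<and> card S \<le> k}"
  let ?F = "\<lambda>S. (\<lambda>u. single u 1 * (\<Prod>j\<in>J - S. R j)) ` (if ?c S \<le> d then mons V (d - ?c S) else {})"
  have sub: "shifted_gens V J R e k d \<subseteq> (\<Union>S\<in>?Ss. ?F S)"
  proof
    fix g assume "g \<in> shifted_gens V J R e k d"
    then obtain u S where *: "S \<in> ?Ss" "keys u \<subseteq> V"
      "mono_degree u + ?c S = d" "g = single u 1 * (\<Prod>j\<in>J - S. R j)"
      unfolding shifted_gens_def by blast
    then have "u \<in> (if ?c S \<le> d then mons V (d - ?c S) else {})" by (auto simp: mons_def)
    then show "g \<in> (\<Union>S\<in>?Ss. ?F S)" using *(1,4) by blast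
  qed
  have fin: "finite ?Ss" using J by simp
  have finF: "finite (?F S)" for S by (simp add: finite_mons V)
  show "finite (shifted_gens V J R e k d)"
    by (rule finite_subset[OF sub]) (use fin finF in blast)
  have "card (shifted_gens V J R e k d) \<le> card (\<Union>S\<in>?Ss. ?F S)"
    by (rule card_mono[OF _ sub]) (use fin finF in blast)
  also have "\<dots> \<le> (\<Sum>S\<in>?Ss. card (?F S))" by (rule card_UN_le[OF fin])
  also have "\<dots> \<le> (\<Sum>S\<in>?Ss. hilb V (?c S) d)"
  proof (rule sum_mono)
    fix S
    show "card (?F S) \<le> hilb V (?c S) d"
      unfolding hilb_def by (auto intro!: card_image_le finite_mons V)
  qed
  finally show "card (shifted_gens V J R e k d) \<le> (\<Sum>S\<in>?Ss. hilb V (?c S) d)" .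
qed

lemma summable_card_mons:
  fixes z :: real
  assumes V: "finite V" and z: "0 < z" "z < 1"
  shows "summable (\<lambda>d. real (card (mons V d)) * z ^ d)"
proof (rule summable_comparison_test)
  show "\<exists>N. \<forall>d\<ge>N. norm (real (card (mons V d)) * z ^ d) \<le> real (Suc d) ^ card V * z ^ d"
  proof (intro exI allI impI)
    fix d :: nat
    have "real (card (mons V d)) \<le> real (Suc d) ^ card V"
      using card_mons_le[OF V, of d] by (metis of_nat_le_iff of_nat_power)
    then show "norm (real (card (mons V d)) * z ^ d) \<le> real (Suc d) ^ card V * z ^ d"
      using z by (simp add: mult_right_mono)
  qed
  \<comment> \<open>Successive terms have ratios tending to \<open>z\<close>, so any number strictly
    between \<open>z\<close> and 1 bounds them eventually.\<close>
  define c where "c = (1 + z) / 2"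
  have "(\<lambda>d. (1 + inverse (real (Suc d))) ^ card V * z) \<longlonglongrightarrow> (1 + 0) ^ card V * z"
    by (intro tendsto_intros LIMSEQ_inverse_real_of_nat)
  moreover have "(1 + 0) ^ card V * z < c" using z by (simp add: c_def)
  ultimately have "\<forall>\<^sub>F d in sequentially. (1 + inverse (real (Suc d))) ^ card V * z < c"
    by (rule order_tendstoD(2))
  then obtain N where N: "\<And>d. d \<ge> N \<Longrightarrow> (1 + inverse (real (Suc d))) ^ card V * z < c"
    by (auto simp: eventually_sequentially)
  show "summable (\<lambda>d. real (Suc d) ^ card V * z ^ d)"
  proof (rule summable_ratio_test)
    show "c < 1" using z by (simp add: c_def)
    fix d assume d: "N \<le> d"
    have "real (Suc (Suc d)) = (1 + inverse (real (Suc d))) * real (Suc d)"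
      by (simp add: field_simps)
    then have "real (Suc (Suc d)) ^ card V * z ^ Suc d =
      ((1 + inverse (real (Suc d))) ^ card V * z) * (real (Suc d) ^ card V * z ^ d)"
      by (simp only: power_mult_distrib power_Suc mult_ac)
    also have "\<dots> \<le> c * (real (Suc d) ^ card V * z ^ d)"
      by (rule mult_right_mono) (use N[OF d] z in auto)
    finally show "norm (real (Suc (Suc d)) ^ card V * z ^ Suc d) \<le> c * norm (real (Suc d) ^ card V * z ^ d)"
      using z by (simp add: abs_mult)
  qed
qed

text \<open>A generator of degree \<open>c\<close> shifts the Hilbert function by \<open>c\<close>,
  which multiplies its series by \<open>z ^ c\<close>. This turns every dimension count into a power
  of \<open>z\<close>.\<close>

lemma hilb_sums:
  fixes z :: real
  assumes V: "finite V" and z: "0 < z" "z < 1"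
  shows "(\<lambda>d. real (hilb V c d) * z ^ d) sums (z ^ c * (suminf (\<lambda>d. real (card (mons V d)) * z ^ d)))"
proof -
  let ?H = "suminf (\<lambda>d. real (card (mons V d)) * z ^ d)"
  have "(\<lambda>d. real (card (mons V d)) * z ^ d) sums ?H"
    by (rule summable_sums[OF summable_card_mons[OF assms]])
  then have "(\<lambda>d. z ^ c * (real (card (mons V d)) * z ^ d)) sums (z ^ c * ?H)"
    by (rule sums_mult)
  then have "(\<lambda>d. real (hilb V c (d + c)) * z ^ (d + c)) sums (z ^ c * ?H)"
    by (simp add: hilb_def power_add mult_ac)
  moreover have "(\<lambda>d. real (hilb V c d) * z ^ d) sums (z ^ c * ?H) \<longleftrightarrow>
    (\<lambda>d. real (hilb V c (d + c)) * z ^ (d + c)) sums (z ^ c * ?H)"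
    by (rule sums_zero_iff_shift[symmetric]) (simp add: hilb_def)
  ultimately show ?thesis by simp
qed

text \<open>The elements lying in exactly one set form disjoint parts \<open>G a\<close>. Each pair
  is subtracted twice, weaker than Bonferroni but sufficient here.\<close>

lemma card_Union_ge:
  fixes F :: "'i \<Rightarrow> 'b set"
  assumes A: "finite A" and fin: "\<And>a. a \<in> A \<Longrightarrow> finite (F a)"
  shows "(\<Sum>a\<in>A. real (card (F a)) - (\<Sum>b\<in>A - {a}. real (card (F a \<inter> F b))))
           \<le> real (card (\<Union>a\<in>A. F a))"
proof -
  define G where "G a = F a - (\<Union>b\<in>A - {a}. F a \<inter> F b)" for a
  have "real (card (F a)) - (\<Sum>b\<in>A - {a}. real (card (F a \<inter> F b))) \<le> real (card (G a))"
    if a: "a \<in> A" for a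
  proof -
    have "card (F a) \<le> card (G a \<union> (\<Union>b\<in>A - {a}. F a \<inter> F b))"
      by (rule card_mono) (use A a fin in \<open>auto simp: G_def\<close>)
    also have "\<dots> \<le> card (G a) + card (\<Union>b\<in>A - {a}. F a \<inter> F b)" by (rule card_Un_le)
    also have "card (\<Union>b\<in>A - {a}. F a \<inter> F b) \<le> (\<Sum>b\<in>A - {a}. card (F a \<inter> F b))"
      by (rule card_UN_le) (use A in simp)
    finally have "real (card (F a)) \<le> real (card (G a) + (\<Sum>b\<in>A - {a}. card (F a \<inter> F b)))"
      by (simp only: of_nat_le_iff)
    then show ?thesis by simp
  qed
  then have "(\<Sum>a\<in>A. real (card (F a)) - (\<Sum>b\<in>A - {a}. real (card (F a \<inter> F b))))
    \<le> (\<Sum>a\<in>A. real (card (G a)))"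
    by (rule sum_mono)
  also have "\<dots> = real (card (\<Union>a\<in>A. G a))"
    by (subst card_UN_disjoint) (use A fin in \<open>auto simp: G_def\<close>)
  also have "\<dots> \<le> real (card (\<Union>a\<in>A. F a))"
    by (intro of_nat_mono card_mono) (use A fin in \<open>auto simp: G_def\<close>)
  finally show ?thesis .
qed

lemma card_multiples_sqfree:
  assumes V: "finite V" and S: "S \<subseteq> V"
  shows "card {u \<in> mons V d. S \<subseteq> keys u} = hilb V (card S) d"
proof -
  have fS: "finite S" using assms finite_subset by blast
  have "S \<subseteq> keys u \<longleftrightarrow> (\<forall>v. lookup (sqfree S) v \<le> lookup u v)" for u
    using fS by (auto simp: lookup_sqfree in_keys_iff subset_iff Suc_le_eq)
  then show ?thesis
    using card_mons_multiple[OF V, of "sqfree S" d] fS S by (simp add: hilb_def)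
qed

text \<open>
  The inequality of dimensions in each degree \<open>d\<close> is weighted by \<open>z\<^sup>d\<close> and summed over all \<open>d\<close>.
  By \<open>hilb_sums\<close> both sides are multiples of the Hilbert series of the whole ring at \<open>z\<close>, which
  cancels, so no binomial coefficients need to be estimated.
\<close>

lemma shifted_partials_bound:
  fixes z :: real and P :: "'a::field mpoly" and R :: "nat \<Rightarrow> nat \<Rightarrow> 'a mpoly"
  assumes V: "finite V" and z: "0 < z" "z < 1"
    and P: "P = (\<Sum>r<T. \<Prod>j\<in>J r. R r j)"
    and J: "\<And>r. r < T \<Longrightarrow> finite (J r)" "\<And>r. r < T \<Longrightarrow> card (J r) \<le> M"
    and R: "\<And>r j. r < T \<Longrightarrow> j \<in> J r \<Longrightarrow> keys (R r j) \<subseteq> mons V (e r j)"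
    and e: "\<And>r j. r < T \<Longrightarrow> j \<in> J r \<Longrightarrow> e r j \<le> E"
    and esum: "\<And>r. r < T \<Longrightarrow> (\<Sum>j\<in>J r. e r j) = D + k"
    and A: "finite A"
    and S: "\<And>a. a \<in> A \<Longrightarrow> S a \<subseteq> V" "\<And>a. a \<in> A \<Longrightarrow> card (S a) = D"
    and W: "\<And>a. a \<in> A \<Longrightarrow> length (W a) = k"
    and der: "\<And>a. a \<in> A \<Longrightarrow> pds (W a) P = single (sqfree (S a)) 1"
  shows "(\<Sum>a\<in>A. z ^ D - (\<Sum>b\<in>A - {a}. z ^ card (S a \<union> S b))) \<le>
           real T * 2 ^ M * z ^ (D + k - k * E)"
proof -
  let ?G = "\<lambda>r d. shifted_gens V (J r) (R r) (e r) k d"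
  let ?Ss = "\<lambda>r. {U. U \<subseteq> J r \<and> card U \<le> k}"
  let ?c = "\<lambda>r U. \<Sum>j\<in>J r - U. e r j"
  let ?H = "suminf (\<lambda>d. real (card (mons V d)) * z ^ d)"
  define F where "F d a = {u \<in> mons V d. S a \<subseteq> keys u}" for d a
  have finF: "finite (F d a)" for d a by (simp add: F_def finite_mons V)
  have finS: "finite (S a)" if "a \<in> A" for a using S(1)[OF that] V finite_subset by blast
  \<comment> \<open>Any multiple \<open>u\<close> of the isolated monomial is a shift of the
    derivative of \<open>P\<close>; expanding \<open>P\<close> into its \<open>T\<close> products
    puts it into the span of all their generators.\<close>
  have span: "single u 1 \<in> mpoly.span (\<Union>r<T. ?G r d)" if a: "a \<in> A" and u: "u \<in> F d a" for a u d
  proof -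
    define w where "w = u - sqfree (S a)"
    have wu: "w + sqfree (S a) = u"
      unfolding w_def by (rule monomial_diff_add)
        (use u finS[OF a] in \<open>auto simp: F_def lookup_sqfree in_keys_iff Suc_le_eq\<close>)
    have w: "keys w \<subseteq> V"
      using u by (auto simp: F_def mons_def w_def in_keys_iff lookup_minus subset_iff)
    have deg: "mono_degree w + D = d"
      using mono_degree_add[of w "sqfree (S a)"] u S(2)[OF a] finS[OF a]
      by (simp add: wu F_def mons_def del: mono_degree_add)
    have "single w 1 * pds (W a) (\<Prod>j\<in>J r. R r j) \<in> mpoly.span (?G r d)" if r: "r < T" for r
    proof -
      \<comment> \<open>The undifferentiated product is itself a generator, with nothing omitted and
        trivial shift.\<close>
      have "single 0 1 * (\<Prod>j\<in>J r - {}. R r j) \<in> shifted_gens V (J r) (R r) (e r) 0 (D + k)"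
        unfolding shifted_gens_def using esum[OF r]
        by (intro CollectI exI[of _ "0::monomial"] exI[of _ "{}"]) auto
      then have "(\<Prod>j\<in>J r. R r j) \<in>
          mpoly.span (shifted_gens V (J r) (R r) (e r) 0 (D + length (W a)))"
        by (simp add: mpoly.span_base W[OF a])
      from pds_shifted_gens[OF J(1)[OF r] R[OF r] this]
      have "pds (W a) (\<Prod>j\<in>J r. R r j) \<in> mpoly.span (?G r D)"
        by (simp add: W[OF a])
      from shift_shifted_gens[OF w this] show ?thesis by (simp only: deg)
    qed
    then have "single w 1 * pds (W a) (\<Prod>j\<in>J r. R r j) \<in> mpoly.span (\<Union>r<T. ?G r d)"
      if "r < T" for r
      using that mpoly.span_mono[of "?G r d" "\<Union>r<T. ?G r d"] by blast
    then have "(\<Sum>r<T. single w 1 * pds (W a) (\<Prod>j\<in>J r. R r j)) \<in> mpoly.span (\<Union>r<T. ?G r d)"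
      by (intro mpoly.span_sum) auto
    moreover have "(\<Sum>r<T. single w 1 * pds (W a) (\<Prod>j\<in>J r. R r j)) = single w 1 * pds (W a) P"
      by (simp add: P pds_sum sum_distrib_left)
    moreover have "single w 1 * pds (W a) P = single u 1"
      by (simp add: der[OF a] mult_single wu)
    ultimately show ?thesis by simp
  qed
  have upper: "card (\<Union>a\<in>A. F d a) \<le> (\<Sum>r<T. \<Sum>U\<in>?Ss r. hilb V (?c r U) d)" for d
  proof -
    have "card (\<Union>a\<in>A. F d a) = card ((\<lambda>u. single u (1::'a)) ` (\<Union>a\<in>A. F d a))"
      by (rule card_image[symmetric], rule inj_onI, drule arg_cong[where f = keys]) simp
    also have "\<dots> \<le> card (\<Union>r<T. ?G r d)"
      using mpoly.independent_span_bound[OF _ independent_singles, of "\<Union>r<T. ?G r d" "\<Union>a\<in>A. F d a"]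
        span shifted_gens_card(1)[OF V J(1)] by blast
    also have "\<dots> \<le> (\<Sum>r<T. card (?G r d))" by (rule card_UN_le) simp
    also have "\<dots> \<le> (\<Sum>r<T. \<Sum>U\<in>?Ss r. hilb V (?c r U) d)"
      by (intro sum_mono shifted_gens_card(2) V J(1)) simp
    finally show ?thesis .
  qed
  have lower: "(\<Sum>a\<in>A. real (hilb V D d) - (\<Sum>b\<in>A - {a}. real (hilb V (card (S a \<union> S b)) d)))
    \<le> real (card (\<Union>a\<in>A. F d a))" for d
  proof -
    have "card (F d a) = hilb V D d" if "a \<in> A" for a
      using card_multiples_sqfree[OF V S(1)[OF that], of d] S(2)[OF that] by (simp add: F_def)
    moreover have "card (F d a \<inter> F d b) = hilb V (card (S a \<union> S b)) d"
      if "a \<in> A" "b \<in> A" for a b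
    proof -
      \<comment> \<open>Common multiples of two squarefree monomials are the multiples of their
        least common multiple, whose degree is the size of the union.\<close>
      have "F d a \<inter> F d b = {u \<in> mons V d. S a \<union> S b \<subseteq> keys u}" by (auto simp: F_def)
      then show ?thesis using card_multiples_sqfree[OF V, of "S a \<union> S b" d] S(1) that by simp
    qed
    ultimately show ?thesis using card_Union_ge[OF A, of "F d"] finF by simp
  qed
  have "(\<Sum>a\<in>A. z ^ D * ?H - (\<Sum>b\<in>A - {a}. z ^ card (S a \<union> S b) * ?H)) \<le>
        (\<Sum>r<T. \<Sum>U\<in>?Ss r. z ^ ?c r U * ?H)"
  proof (rule sums_le)
    show "(\<lambda>d. \<Sum>a\<in>A. real (hilb V D d) * z ^ d -
             (\<Sum>b\<in>A - {a}. real (hilb V (card (S a \<union> S b)) d) * z ^ d)) sums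
          (\<Sum>a\<in>A. z ^ D * ?H - (\<Sum>b\<in>A - {a}. z ^ card (S a \<union> S b) * ?H))"
      by (intro sums_sum sums_diff hilb_sums V z)
    show "(\<lambda>d. \<Sum>r<T. \<Sum>U\<in>?Ss r. real (hilb V (?c r U) d) * z ^ d) sums
          (\<Sum>r<T. \<Sum>U\<in>?Ss r. z ^ ?c r U * ?H)"
      by (intro sums_sum hilb_sums V z)
    fix d
    have "(\<Sum>a\<in>A. real (hilb V D d) - (\<Sum>b\<in>A - {a}. real (hilb V (card (S a \<union> S b)) d)))
      \<le> real (\<Sum>r<T. \<Sum>U\<in>?Ss r. hilb V (?c r U) d)"
      using lower[of d] upper[of d] by linarith
    then have "(\<Sum>a\<in>A. real (hilb V D d) - (\<Sum>b\<in>A - {a}. real (hilb V (card (S a \<union> S b)) d))) * z ^ d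
      \<le> real (\<Sum>r<T. \<Sum>U\<in>?Ss r. hilb V (?c r U) d) * z ^ d"
      using z by (intro mult_right_mono) auto
    then show "(\<Sum>a\<in>A. real (hilb V D d) * z ^ d -
             (\<Sum>b\<in>A - {a}. real (hilb V (card (S a \<union> S b)) d) * z ^ d)) \<le>
          (\<Sum>r<T. \<Sum>U\<in>?Ss r. real (hilb V (?c r U) d) * z ^ d)"
      by (simp add: sum_distrib_right left_diff_distrib)
  qed
  also have "\<dots> \<le> (\<Sum>r<T. \<Sum>U\<in>?Ss r. z ^ (D + k - k * E) * ?H)"
  proof (intro sum_mono mult_right_mono)
    fix r U assume r: "r \<in> {..<T}" and U: "U \<in> ?Ss r"
    \<comment> \<open>At most \<open>k\<close> factors of degree at most \<open>E\<close> are
      omitted, so at least \<open>D + k - k * E\<close> of the degree remains. If the difference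
      truncates to 0 the bound is still valid, since z < 1.\<close>
    have "(\<Sum>j\<in>U. e r j) \<le> card U * E"
      using sum_bounded_above[of U "e r" E] e r U by auto
    also have "\<dots> \<le> k * E" using U by simp
    finally have "D + k - k * E \<le> ?c r U"
      using sum.subset_diff[of U "J r" "e r"] U J(1) r esum[of r] by auto
    then show "z ^ ?c r U \<le> z ^ (D + k - k * E)"
      using z by (intro power_decreasing) auto
  next
    show "0 \<le> ?H" using z by (intro suminf_nonneg summable_card_mons V) auto
  qed
  also have "\<dots> \<le> (\<Sum>r<T. 2 ^ M * (z ^ (D + k - k * E) * ?H))"
  proof (intro sum_mono)
    fix r assume r: "r \<in> {..<T}"
    have "card (?Ss r) \<le> card (Pow (J r))"
      by (rule card_mono) (use J(1) r in auto)
    also have "\<dots> \<le> 2 ^ M" using J[of r] r by (simp add: card_Pow)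
    finally have "real (card (?Ss r)) \<le> 2 ^ M" by (metis of_nat_le_iff of_nat_numeral of_nat_power)
    moreover have "0 \<le> z ^ (D + k - k * E) * ?H"
      using z by (intro mult_nonneg_nonneg suminf_nonneg summable_card_mons V) auto
    ultimately show "(\<Sum>U\<in>?Ss r. z ^ (D + k - k * E) * ?H) \<le> 2 ^ M * (z ^ (D + k - k * E) * ?H)"
      by (simp add: mult_right_mono)
  qed
  also have "(\<Sum>a\<in>A. z ^ D * ?H - (\<Sum>b\<in>A - {a}. z ^ card (S a \<union> S b) * ?H)) =
    (\<Sum>a\<in>A. z ^ D - (\<Sum>b\<in>A - {a}. z ^ card (S a \<union> S b))) * ?H"
    by (simp add: sum_distrib_right left_diff_distrib)
  finally have "(\<Sum>a\<in>A. z ^ D - (\<Sum>b\<in>A - {a}. z ^ card (S a \<union> S b))) * ?H \<le>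
    (real T * 2 ^ M * z ^ (D + k - k * E)) * ?H"
    by (simp add: mult.assoc)
  \<comment> \<open>The monomial 1 already contributes in degree 0, so the common factor can be
    cancelled.\<close>
  moreover have "?H > 0"
  proof (rule suminf_pos2[where i = 0])
    have "mons V 0 \<noteq> {}" by (auto simp: mons_def intro: exI[of _ 0])
    then show "0 < real (card (mons V 0)) * z ^ 0" by (simp add: card_gt_0_iff finite_mons V)
  qed (use z in \<open>auto intro: summable_card_mons V\<close>)
  ultimately show ?thesis by simp
qed


section \<open>A program for the coefficients\<close>

text \<open>Memory is fixed across the run because it only holds the input exponents and is never
  written; assertions therefore speak of registers alone.\<close>

definition runs ::
    "ram \<Rightarrow> (nat \<Rightarrow> nat) \<Rightarrow> (nat \<Rightarrow> nat) \<Rightarrow> nat \<Rightarrow> ((nat \<Rightarrow> nat) \<Rightarrow> bool) \<Rightarrow> bool" where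
  "runs c mem r B Q \<longleftrightarrow> (\<exists>k\<le>B. \<exists>r'. ram_exec c (r, mem) k (r', mem) \<and> Q r')"

lemma runs_mono: "runs c mem r B Q \<Longrightarrow> B \<le> B' \<Longrightarrow> (\<And>r. Q r \<Longrightarrow> Q' r) \<Longrightarrow> runs c mem r B' Q'"
  unfolding runs_def using order_trans by blast

lemma runs_Seq:
  assumes "runs c mem r B I" "\<And>r. I r \<Longrightarrow> runs d mem r B' Q"
  shows "runs (Seq c d) mem r (B + B') Q"
proof -
  from assms obtain k r' k' r'' where "k \<le> B" "ram_exec c (r, mem) k (r', mem)"
    "k' \<le> B'" "ram_exec d (r', mem) k' (r'', mem)" "Q r''"
    unfolding runs_def by blast
  then show ?thesis unfolding runs_def
    by (intro exI[of _ "k + k'"] conjI exI[of _ r''] ram_exec.intros) auto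
qed

text \<open>The index of \<open>I\<close> counts the remaining iterations, so one induction yields
  correctness, termination and the step count.\<close>

lemma runs_While:
  assumes body: "\<And>j r. I (Suc j) r \<Longrightarrow> r x \<noteq> 0 \<and> runs c mem r B (I j)"
    and exit: "\<And>r. I 0 r \<Longrightarrow> r x = 0"
  shows "I j r \<Longrightarrow> runs (While_nonzero x c) mem r (j * (B + 1) + 1) (I 0)"
proof (induction j arbitrary: r)
  case 0
  then show ?case unfolding runs_def
    using exit by (intro exI[of _ "1::nat"] conjI exI[of _ r] ram_exec.intros) auto
next
  case (Suc j)
  from body[OF Suc.prems] obtain k r' where k: "k \<le> B" "ram_exec c (r, mem) k (r', mem)" "I j r'"
    and x: "r x \<noteq> 0"
    unfolding runs_def by blast
  from Suc.IH[OF k(3)] obtain l r'' where l: "l \<le> j * (B + 1) + 1"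
    "ram_exec (While_nonzero x c) (r', mem) l (r'', mem)" "I 0 r''"
    unfolding runs_def by blast
  have "ram_exec (While_nonzero x c) (r, mem) (k + l + 1) (r'', mem)"
    using x k(2) l(2) by (rule ram_exec.intros)
  moreover have "k + l + 1 \<le> Suc j * (B + 1) + 1" using k(1) l(1) by simp
  ultimately show ?case unfolding runs_def using l(3) by blast
qed

text \<open>Symbolic execution of loop-free code, which reduces invariant checks to simplification.
  The catch-all equation is right for \<open>Skip\<close>; \<open>is_straight\<close> excludes the
  other programs it covers.\<close>

fun straight :: "ram \<Rightarrow> (nat \<Rightarrow> nat) \<Rightarrow> (nat \<Rightarrow> nat) \<Rightarrow> nat \<Rightarrow> nat" where
  "straight (Load_const x c) mem r = r(x := c)"
| "straight (Add x y z) mem r = r(x := r y + r z)"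
| "straight (Sub x y z) mem r = r(x := r y - r z)"
| "straight (Load x y) mem r = r(x := mem (r y))"
| "straight (Seq c d) mem r = straight d mem (straight c mem r)"
| "straight (If_nonzero x c d) mem r = (if r x \<noteq> 0 then straight c mem r else straight d mem r)"
| "straight _ mem r = r"

fun is_straight :: "ram \<Rightarrow> bool" where
  "is_straight (Seq c d) \<longleftrightarrow> is_straight c \<and> is_straight d"
| "is_straight (If_nonzero x c d) \<longleftrightarrow> is_straight c \<and> is_straight d"
| "is_straight (Store x y) \<longleftrightarrow> False"
| "is_straight (While_nonzero x c) \<longleftrightarrow> False"
| "is_straight _ \<longleftrightarrow> True"

text \<open>An upper bound only: a conditional is charged for both branches.\<close>

fun straight_cost :: "ram \<Rightarrow> nat" where
  "straight_cost (Seq c d) = straight_cost c + straight_cost d"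
| "straight_cost (If_nonzero x c d) = straight_cost c + straight_cost d + 1"
| "straight_cost _ = 1"

lemma runs_straight:
  assumes "is_straight c" "Q (straight c mem r)"
  shows "runs c mem r (straight_cost c) Q"
proof -
  have "\<exists>k\<le>straight_cost c. ram_exec c (r, mem) k (straight c mem r, mem)"
    using assms(1)
  proof (induction c arbitrary: r)
    case (Seq c d)
    then obtain k l where "k \<le> straight_cost c" "ram_exec c (r, mem) k (straight c mem r, mem)"
      "l \<le> straight_cost d"
      "ram_exec d (straight c mem r, mem) l (straight d mem (straight c mem r), mem)"
      by fastforce
    then show ?case
      by (intro exI[of _ "k + l"]) (auto intro: ram_exec.intros)
  next
    case (If_nonzero x c d)
    show ?case
    proof (cases "r x = 0")
      case True
      obtain l where "l \<le> straight_cost d" "ram_exec d (r, mem) l (straight d mem r, mem)"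
        using If_nonzero by fastforce
      then show ?thesis
        using True ram_exec.intros(9)[of r x, OF True, of d mem l "(straight d mem r, mem)" c]
        by (intro exI[of _ "l + 1"]) simp
    next
      case False
      obtain l where "l \<le> straight_cost c" "ram_exec c (r, mem) l (straight c mem r, mem)"
        using If_nonzero by fastforce
      then show ?thesis
        using False ram_exec.intros(8)[of r x, OF False, of c mem l "(straight c mem r, mem)" d]
        by (intro exI[of _ "l + 1"]) simp
    qed
  qed (auto intro!: exI[of _ "Suc 0"] intro: ram_exec.intros[unfolded One_nat_def])
  then show ?thesis using assms(2) unfolding runs_def by blast
qed

abbreviation seqs :: "ram list \<Rightarrow> ram" where
  "seqs cs \<equiv> foldr Seq cs Skip"

text \<open>
  Registers: 0 and 1 hold the inputs, 2 counts violations, 3 the remaining rows, 4 is the current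
  address, 5 the row number modulo \<open>t\<close>, 6 counts the remaining columns, 7 is the row sum, 9 holds 1,
  13 holds 0. In \<open>row_end\<close>, register 11 becomes zero exactly when register 5 equals \<open>t\<close>; testing
  equality instead of \<open>\<le>\<close> gives the convention \<open>x mod 0 = x\<close>.
\<close>

definition cell_body :: ram where
  "cell_body = seqs [Load 8 4, Add 7 7 8,
     If_nonzero 5
       (seqs [Sub 10 4 0, Load 10 10, Sub 11 8 10, Add 2 2 11, Sub 11 10 8, Add 2 2 11]) Skip,
     Add 4 4 9, Sub 6 6 9]"

definition row_start :: ram where
  "row_start = seqs [Load_const 7 0, Add 6 0 13]"

text \<open>As in \<open>cell_body\<close>, an equality test adds both truncated differences to the
  violation counter; here the row sum is compared with 1.\<close>

definition row_end :: ram where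
  "row_end = seqs [Sub 11 7 9, Add 2 2 11, Sub 11 9 7, Add 2 2 11, Add 5 5 9,
     Sub 11 1 5, Sub 12 5 1, Add 11 11 12, If_nonzero 11 Skip (Load_const 5 0), Sub 3 3 9]"

definition row_body :: ram where
  "row_body = Seq row_start (Seq (While_nonzero 6 cell_body) row_end)"

definition coeff_prog :: ram where
  "coeff_prog = Seq (seqs [Load_const 9 1, Add 3 0 13]) (Seq (While_nonzero 3 row_body) (Sub 0 9 2))"

text \<open>A test that looks only at a row and its predecessor, so one pass over the matrix
  suffices. A sum of naturals equal to 1 means a single entry 1. Outside the first row of a band
  \<open>\<rho>\<close> is positive, so subtracting \<open>n\<close> does not truncate.\<close>

definition row_ok :: "nat \<Rightarrow> nat \<Rightarrow> (nat \<Rightarrow> nat) \<Rightarrow> nat \<Rightarrow> bool" where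
  "row_ok n t mem \<rho> \<longleftrightarrow> (\<Sum>a<n. mem (\<rho> * n + a)) = 1 \<and>
     (\<rho> mod t \<noteq> 0 \<longrightarrow> (\<forall>a<n. mem (\<rho> * n + a) = mem (\<rho> * n + a - n)))"

text \<open>\<open>R\<close> is the number of rows still to be read. Of the violation counter only
  its vanishing is tracked: it never decreases.\<close>

definition row_inv :: "nat \<Rightarrow> nat \<Rightarrow> (nat \<Rightarrow> nat) \<Rightarrow> nat \<Rightarrow> (nat \<Rightarrow> nat) \<Rightarrow> bool" where
  "row_inv n t mem R r \<longleftrightarrow> R \<le> n \<and> r 0 = n \<and> r 1 = t \<and> r 3 = R \<and> r 4 = (n - R) * n \<and>
     r 5 = (n - R) mod t \<and> r 9 = 1 \<and> r 13 = 0 \<and> (r 2 = 0 \<longleftrightarrow> (\<forall>\<rho><n - R. row_ok n t mem \<rho>))"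

definition cell_inv :: "nat \<Rightarrow> nat \<Rightarrow> (nat \<Rightarrow> nat) \<Rightarrow> nat \<Rightarrow> nat \<Rightarrow> (nat \<Rightarrow> nat) \<Rightarrow> bool" where
  "cell_inv n t mem \<rho> j r \<longleftrightarrow> \<rho> < n \<and> j \<le> n \<and> r 0 = n \<and> r 1 = t \<and> r 3 = n - \<rho> \<and>
     r 4 = \<rho> * n + (n - j) \<and> r 5 = \<rho> mod t \<and> r 6 = j \<and> r 7 = (\<Sum>a<n - j. mem (\<rho> * n + a)) \<and>
     r 9 = 1 \<and> r 13 = 0 \<and>
     (r 2 = 0 \<longleftrightarrow> (\<forall>\<rho>'<\<rho>. row_ok n t mem \<rho>') \<and>
        (\<rho> mod t \<noteq> 0 \<longrightarrow> (\<forall>a<n - j. mem (\<rho> * n + a) = mem (\<rho> * n + a - n))))"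

lemma cell_body_correct:
  assumes "cell_inv n t mem \<rho> (Suc j) r"
  shows "cell_inv n t mem \<rho> j (straight cell_body mem r)"
proof -
  define i where "i = n - Suc j"
  have i: "n - j = Suc i" "n - Suc j = i" using assms by (auto simp: i_def cell_inv_def)
  show ?thesis
    using assms unfolding cell_inv_def i
    by (auto simp: cell_body_def lessThan_Suc less_Suc_eq)
qed

lemma row_body_correct:
  assumes "row_inv n t mem (Suc R) r"
  shows "runs row_body mem r (n * 21 + 20) (row_inv n t mem R)"
proof -
  define \<rho> where "\<rho> = n - Suc R"
  have \<rho>: "\<rho> < n" "n - Suc R = \<rho>" "n - R = Suc \<rho>" "R = n - Suc \<rho>"
    using assms by (auto simp: \<rho>_def row_inv_def)
  have "cell_inv n t mem \<rho> n (straight row_start mem r)"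
    using assms \<rho> unfolding row_inv_def cell_inv_def by (auto simp: row_start_def)
  moreover have "runs (While_nonzero 6 cell_body) mem r (n * (straight_cost cell_body + 1) + 1)
      (cell_inv n t mem \<rho> 0)" if "cell_inv n t mem \<rho> n r" for r
  proof (rule runs_While[where I = "cell_inv n t mem \<rho>", OF _ _ that])
    fix j r assume "cell_inv n t mem \<rho> (Suc j) r"
    then show "r 6 \<noteq> 0 \<and> runs cell_body mem r (straight_cost cell_body) (cell_inv n t mem \<rho> j)"
      by (intro conjI runs_straight cell_body_correct) (auto simp: cell_inv_def cell_body_def)
  qed (simp add: cell_inv_def)
  moreover have "row_inv n t mem R (straight row_end mem r)" if "cell_inv n t mem \<rho> 0 r" for r
  proof -
    have ok: "row_ok n t mem \<rho> \<longleftrightarrow> r 7 = 1 \<and>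
      (\<rho> mod t \<noteq> 0 \<longrightarrow> (\<forall>a<n. mem (\<rho> * n + a) = mem (\<rho> * n + a - n)))"
      using that by (simp add: row_ok_def cell_inv_def)
    have "(\<forall>\<rho>'<Suc \<rho>. row_ok n t mem \<rho>') \<longleftrightarrow>
      (\<forall>\<rho>'<\<rho>. row_ok n t mem \<rho>') \<and> row_ok n t mem \<rho>"
      using less_Suc_eq by auto
    \<comment> \<open>The reset of register 5 mirrors the case distinction in
      \<open>mod_Suc\<close>.\<close>
    then show ?thesis
      using that \<rho> unfolding row_inv_def cell_inv_def ok
      by (auto simp: row_end_def mod_Suc)
  qed
  ultimately have "runs row_body mem r
    (straight_cost row_start + (n * (straight_cost cell_body + 1) + 1 + straight_cost row_end))
    (row_inv n t mem R)"
    unfolding row_body_def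
    by (intro runs_Seq[where I = "cell_inv n t mem \<rho> n"] runs_Seq[where I = "cell_inv n t mem \<rho> 0"]
        runs_straight) (simp_all add: row_start_def row_end_def)
  then show ?thesis
    by (rule runs_mono) (simp_all add: row_start_def row_end_def cell_body_def)
qed

lemma coeff_prog_correct:
  "\<exists>k r mem. ram_exec coeff_prog (ram_input n t m) k (r, mem) \<and> k \<le> (n + mono_degree m + 2) ^ 7 \<and>
     r 0 = (if \<forall>\<rho><n. row_ok n t (Poly_Mapping.lookup m) \<rho> then 1 else 0)"
proof -
  let ?mem = "Poly_Mapping.lookup m"
  let ?r = "(\<lambda>_. 0)(0 := n, 1 := t) :: nat \<Rightarrow> nat"
  let ?Q = "\<lambda>r. r 0 = (if \<forall>\<rho><n. row_ok n t ?mem \<rho> then 1 else 0 :: nat)"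
  have "row_inv n t ?mem n (straight (seqs [Load_const 9 1, Add 3 0 13]) ?mem ?r)"
    by (simp add: row_inv_def)
  moreover have "runs (While_nonzero 3 row_body) ?mem r (n * (n * 21 + 20 + 1) + 1) (row_inv n t ?mem 0)"
    if "row_inv n t ?mem n r" for r
  proof (rule runs_While[where I = "row_inv n t ?mem", OF _ _ that])
    fix R r assume "row_inv n t ?mem (Suc R) r"
    then show "r 3 \<noteq> 0 \<and> runs row_body ?mem r (n * 21 + 20) (row_inv n t ?mem R)"
      by (intro conjI row_body_correct) (auto simp: row_inv_def)
  qed (simp add: row_inv_def)
  moreover have "?Q (straight (Sub 0 9 2) ?mem r)" if "row_inv n t ?mem 0 r" for r
    using that by (auto simp: row_inv_def)
  ultimately have "runs coeff_prog ?mem ?r (straight_cost (seqs [Load_const 9 1, Add 3 0 13]) +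
      (n * (n * 21 + 20 + 1) + 1 + straight_cost (Sub 0 9 2))) ?Q"
    unfolding coeff_prog_def
    by (intro runs_Seq[where I = "row_inv n t ?mem n"] runs_Seq[where I = "row_inv n t ?mem 0"]
        runs_straight) simp_all
  then have "runs coeff_prog ?mem ?r (n * (n * 21 + 21) + 5) ?Q"
    by (rule runs_mono) simp_all
  then obtain k r where k: "k \<le> n * (n * 21 + 21) + 5" "ram_exec coeff_prog (?r, ?mem) k (r, ?mem)" "?Q r"
    unfolding runs_def by blast
  let ?x = "n + 2"
  \<comment> \<open>The constant 2^5 is absorbed by five further powers of n + 2, giving exponent
    7.\<close>
  have "n * (n * 21 + 21) + 5 \<le> 2 ^ 5 * ?x ^ 2" by (simp add: power2_eq_square algebra_simps)
  also have "\<dots> \<le> ?x ^ 5 * ?x ^ 2" by (intro mult_right_mono power_mono) auto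
  also have "\<dots> = ?x ^ 7" by (simp flip: power_add)
  also have "\<dots> \<le> (n + mono_degree m + 2) ^ 7" by (rule power_mono) auto
  finally show ?thesis using k unfolding ram_input_def by fastforce
qed


section \<open>Homogeneous polynomials\<close>

text \<open>Inclusion of the keys in \<open>mons V d\<close> serves as homogeneity of degree
  \<open>d\<close> over \<open>V\<close>. The zero polynomial satisfies it for every
  \<open>d\<close>, so sums and products need no case distinction.\<close>

lemma keys_mult_mons:
  fixes p q :: "'a::comm_ring_1 mpoly"
  shows "keys p \<subseteq> mons V d \<Longrightarrow> keys q \<subseteq> mons V e \<Longrightarrow> keys (p * q) \<subseteq> mons V (d + e)"
  using keys_mult[of p q] mons_add by blast

lemma keys_sum_mons:
  fixes f :: "'i \<Rightarrow> 'a::comm_ring_1 mpoly"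
  shows "(\<And>x. x \<in> A \<Longrightarrow> keys (f x) \<subseteq> mons V d) \<Longrightarrow> keys (sum f A) \<subseteq> mons V d"
proof (induction A rule: infinite_finite_induct)
  case (insert x A)
  then show ?case using keys_add[of "f x" "sum f A"] by fastforce
qed auto

lemma keys_prod_list_mons:
  fixes f :: "'i \<Rightarrow> 'a::comm_ring_1 mpoly"
  shows "(\<And>x. x \<in> set xs \<Longrightarrow> keys (f x) \<subseteq> mons V (e x)) \<Longrightarrow>
    keys (prod_list (map f xs)) \<subseteq> mons V (sum_list (map e xs))"
proof (induction xs)
  case Nil
  then show ?case by (auto simp: mons_def)
next
  case (Cons x xs)
  then show ?case using keys_mult_mons[of "f x" V "e x"] by simp
qed

lemma homogeneous_polyI: "keys p \<subseteq> mons V d \<Longrightarrow> homogeneous_poly p"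
  unfolding homogeneous_poly_def mons_def by blast

lemma total_degree_le: "keys p \<subseteq> mons V d \<Longrightarrow> total_degree p \<le> d"
  by (auto simp: total_degree_def mons_def)

lemma total_degree_eq:
  assumes "keys p \<subseteq> mons V d" "p \<noteq> 0"
  shows "total_degree p = d"
proof -
  from assms(2) have "keys p \<noteq> {}"
    by (metis keys_eq_empty)
  then obtain m where "m \<in> keys p" by blast
  with assms(1) have "mono_degree ` keys p = {d}" unfolding mons_def by blast
  then show ?thesis by (simp add: total_degree_def)
qed


section \<open>The family\<close>

text \<open>The variables form an \<open>n \<times> n\<close> matrix, split into \<open>nblocks n t\<close> bands of \<open>t\<close> consecutive
  rows (the last band may be thinner). A monomial selects one column in each band.\<close>

definition nblocks :: "nat \<Rightarrow> nat \<Rightarrow> nat" where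
  "nblocks n t = (if n = 0 then 0 else (n - 1) div t + 1)"

definition choices :: "nat \<Rightarrow> nat \<Rightarrow> (nat \<Rightarrow> nat) set" where
  "choices n t = {..<nblocks n t} \<rightarrow>\<^sub>E {..<n}"

definition cells :: "nat \<Rightarrow> nat \<Rightarrow> (nat \<Rightarrow> nat) \<Rightarrow> nat set" where
  "cells n t \<alpha> = (\<lambda>\<rho>. \<rho> * n + \<alpha> (\<rho> div t)) ` {..<n}"

text \<open>Given in expanded form, from which coefficients and derivatives are read off; the
  factored form is recovered in \<open>computed_band_circuit\<close>.\<close>

definition band_poly :: "nat \<Rightarrow> nat \<Rightarrow> 'a::field mpoly" where
  "band_poly n t = (\<Sum>\<alpha>\<in>choices n t. single (sqfree (cells n t \<alpha>)) 1)"

lemma div_less_nblocks: "\<rho> < n \<Longrightarrow> \<rho> div t < nblocks n t"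
  by (auto simp: nblocks_def less_Suc_eq_le intro: div_le_mono)

text \<open>The family must exist for every \<open>n\<close>, even where \<open>t\<close> is 0.
  Division by 0 then gives one band holding all rows.\<close>

lemma nblocks_mult_less: "i < nblocks n t \<Longrightarrow> i * t < n"
  by (cases "t = 0") (auto simp: nblocks_def less_Suc_eq_le less_eq_div_iff_mult_less_eq split: if_splits)

lemma nblocks_mult_div: "i < nblocks n t \<Longrightarrow> i * t div t = i"
  by (cases "t = 0") (auto simp: nblocks_def split: if_splits)

lemma finite_choices: "finite (choices n t)"
  by (simp add: choices_def finite_PiE)

lemma choices_nonempty: "choices n t \<noteq> {}"
  by (auto simp: choices_def PiE_eq_empty_iff nblocks_def)

lemma choices_less: "\<alpha> \<in> choices n t \<Longrightarrow> \<rho> < n \<Longrightarrow> \<alpha> (\<rho> div t) < n"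
  using div_less_nblocks by (fastforce simp: choices_def)

lemma finite_cells [simp]: "finite (cells n t \<alpha>)"
  by (simp add: cells_def)

lemma cell_eq_iff:
  fixes n a b :: nat
  assumes "a < n" "b < n"
  shows "\<rho> * n + a = \<rho>' * n + b \<longleftrightarrow> \<rho> = \<rho>' \<and> a = b"
proof
  assume e: "\<rho> * n + a = \<rho>' * n + b"
  have "(\<rho> * n + a) div n = \<rho>" "(\<rho>' * n + b) div n = \<rho>'" using assms by auto
  then show "\<rho> = \<rho>' \<and> a = b" using e by simp
qed simp

lemma cell_less: "\<rho> < n \<Longrightarrow> a < n \<Longrightarrow> \<rho> * n + a < (n::nat)\<^sup>2"
proof -
  assume "\<rho> < n" "a < n"
  then have "\<rho> * n + a < \<rho> * n + n" by simp
  also have "\<dots> = Suc \<rho> * n" by simp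
  also have "\<dots> \<le> n * n" by (rule mult_right_mono) (use \<open>\<rho> < n\<close> in auto)
  finally show ?thesis by (simp add: power2_eq_square)
qed

lemma cell_in_cells_iff:
  assumes "\<alpha> \<in> choices n t" "\<rho> < n" "a < n"
  shows "\<rho> * n + a \<in> cells n t \<alpha> \<longleftrightarrow> a = \<alpha> (\<rho> div t)"
proof
  assume "\<rho> * n + a \<in> cells n t \<alpha>"
  then obtain \<rho>' where "\<rho>' < n" "\<rho> * n + a = \<rho>' * n + \<alpha> (\<rho>' div t)"
    by (auto simp: cells_def)
  then show "a = \<alpha> (\<rho> div t)"
    using cell_eq_iff[OF assms(3) choices_less[OF assms(1)]] by simp
qed (use assms(2) in \<open>simp add: cells_def\<close>)

lemma cells_subset: "\<alpha> \<in> choices n t \<Longrightarrow> cells n t \<alpha> \<subseteq> {..<n\<^sup>2}"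
  by (auto simp: cells_def intro: cell_less choices_less)

lemma inj_on_cells_row: "\<alpha> \<in> choices n t \<Longrightarrow> inj_on (\<lambda>\<rho>. \<rho> * n + \<alpha> (\<rho> div t)) {..<n}"
  by (rule inj_onI) (simp add: cell_eq_iff choices_less)

lemma card_cells: "\<alpha> \<in> choices n t \<Longrightarrow> card (cells n t \<alpha>) = n"
  unfolding cells_def by (simp add: card_image inj_on_cells_row)

lemma inj_on_cells: "inj_on (cells n t) (choices n t)"
proof (rule inj_onI)
  fix \<alpha> \<beta> assume *: "\<alpha> \<in> choices n t" "\<beta> \<in> choices n t" "cells n t \<alpha> = cells n t \<beta>"
  have "\<alpha> i = \<beta> i" if i: "i < nblocks n t" for i
  proof -
    have r: "i * t < n" "i * t div t = i" using i nblocks_mult_less nblocks_mult_div by auto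
    have "i * t * n + \<alpha> i \<in> cells n t \<alpha>"
      using r by (force simp: cells_def)
    then show ?thesis
      using cell_in_cells_iff[OF *(2) r(1), of "\<alpha> i"] *(3) choices_less[OF *(1) r(1)] by (simp add: r(2))
  qed
  then show "\<alpha> = \<beta>" using * by (auto simp: choices_def intro: PiE_ext)
qed

lemma inj_on_sqfree_cells: "inj_on (\<lambda>\<alpha>. sqfree (cells n t \<alpha>)) (choices n t)"
  using inj_on_cells by (auto simp: inj_on_def dest!: arg_cong[where f = keys])

text \<open>Distinct choices give distinct monomials, so no coefficients add up and all are 0 or 1
  in any field.\<close>

lemma lookup_band_poly:
  "lookup (band_poly n t :: 'a::field mpoly) m =
     (if m \<in> (\<lambda>\<alpha>. sqfree (cells n t \<alpha>)) ` choices n t then 1 else 0)"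
proof -
  have "(band_poly n t :: 'a mpoly) = (\<Sum>m\<in>(\<lambda>\<alpha>. sqfree (cells n t \<alpha>)) ` choices n t. single m 1)"
    by (simp add: band_poly_def sum.reindex[OF inj_on_sqfree_cells])
  then show ?thesis by (simp add: lookup_sum lookup_single when_def finite_choices)
qed

lemma keys_band_poly:
  "keys (band_poly n t :: 'a::field mpoly) = (\<lambda>\<alpha>. sqfree (cells n t \<alpha>)) ` choices n t"
proof (intro set_eqI)
  fix m
  show "m \<in> keys (band_poly n t :: 'a mpoly) \<longleftrightarrow> m \<in> (\<lambda>\<alpha>. sqfree (cells n t \<alpha>)) ` choices n t"
    unfolding in_keys_iff lookup_band_poly
    by (cases "m \<in> (\<lambda>\<alpha>. sqfree (cells n t \<alpha>)) ` choices n t") simp_all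
qed

lemma keys_band_poly_mons: "keys (band_poly n t :: 'a::field mpoly) \<subseteq> mons {..<n\<^sup>2} n"
  using cells_subset by (force simp: keys_band_poly mons_def card_cells)

lemma band_poly_nonzero: "(band_poly n t :: 'a::field mpoly) \<noteq> 0"
  using choices_nonempty[of n t] keys_band_poly[of n t, where 'a = 'a] by auto

lemma vars_band_poly: "vars (band_poly n t :: 'a::field mpoly) = {..<n\<^sup>2}"
proof
  show "vars (band_poly n t :: 'a mpoly) \<subseteq> {..<n\<^sup>2}"
    using keys_band_poly_mons[of n t, where 'a = 'a] by (auto simp: vars_def mons_def)
  show "{..<n\<^sup>2} \<subseteq> vars (band_poly n t :: 'a mpoly)"
  proof
    fix v assume v: "v \<in> {..<n\<^sup>2}"
    then have "0 < n" by (cases n) auto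
    with v have n: "v div n < n" "v mod n < n"
      by (auto simp: power2_eq_square less_mult_imp_div_less)
    define \<alpha> where "\<alpha> = restrict (\<lambda>_. v mod n) {..<nblocks n t}"
    have \<alpha>: "\<alpha> \<in> choices n t" using n by (auto simp: \<alpha>_def choices_def)
    have "v div n * n + v mod n \<in> cells n t \<alpha>"
      using cell_in_cells_iff[OF \<alpha> n] div_less_nblocks[OF n(1)] by (simp add: \<alpha>_def)
    then have "v \<in> cells n t \<alpha>" by simp
    then show "v \<in> vars (band_poly n t :: 'a mpoly)"
      using \<alpha> by (auto simp: vars_def keys_band_poly)
  qed
qed

section \<open>Recognising the monomials of the family by local row tests\<close>

lemma row_ok_sqfree:
  assumes \<alpha>: "\<alpha> \<in> choices n t" and \<rho>: "\<rho> < n"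
  shows "row_ok n t (lookup (sqfree (cells n t \<alpha>))) \<rho>"
proof -
  have l: "lookup (sqfree (cells n t \<alpha>)) (\<rho>' * n + a) = (if a = \<alpha> (\<rho>' div t) then 1 else 0)"
    if "\<rho>' < n" "a < n" for \<rho>' a
    using cell_in_cells_iff[OF \<alpha> that] by (simp add: lookup_sqfree)
  have "(\<Sum>a<n. lookup (sqfree (cells n t \<alpha>)) (\<rho> * n + a)) = 1"
    using \<rho> choices_less[OF \<alpha> \<rho>] by (simp add: l)
  moreover have "lookup (sqfree (cells n t \<alpha>)) (\<rho> * n + a) =
      lookup (sqfree (cells n t \<alpha>)) (\<rho> * n + a - n)" if m: "\<rho> mod t \<noteq> 0" and a: "a < n" for a
  proof -
    obtain \<rho>' where \<rho>': "\<rho> = Suc \<rho>'" using m by (cases \<rho>) auto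
    have "\<rho>' div t = \<rho> div t" using m by (auto simp: \<rho>' div_Suc)
    then show ?thesis using l[OF \<rho> a] l[of \<rho>' a] \<rho> a by (simp add: \<rho>')
  qed
  ultimately show ?thesis by (simp add: row_ok_def)
qed

text \<open>Each row that does not start a band copies its predecessor, so induction leads back to
  the first row of the band.\<close>

lemma band_start:
  assumes ok: "\<And>\<rho>. \<rho> < n \<Longrightarrow> row_ok n t f \<rho>" and "\<rho> < n" "a < n"
  shows "f (\<rho> * n + a) = f (\<rho> div t * t * n + a)"
  using assms(2)
proof (induction \<rho>)
  case (Suc \<rho>)
  show ?case
  proof (cases "Suc \<rho> mod t = 0")
    case True
    then show ?thesis by (metis add.right_neutral div_mult_mod_eq)
  next
    case False
    have "f (Suc \<rho> * n + a) = f (\<rho> * n + a)"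
      using ok[OF Suc.prems] False assms(3) by (simp add: row_ok_def)
    moreover have "\<rho> div t = Suc \<rho> div t" using False by (auto simp: div_Suc)
    ultimately show ?thesis using Suc by simp
  qed
qed simp

lemma monomial_iff_rows_ok:
  assumes m: "keys m \<subseteq> {..<n\<^sup>2}"
  shows "m \<in> (\<lambda>\<alpha>. sqfree (cells n t \<alpha>)) ` choices n t \<longleftrightarrow> (\<forall>\<rho><n. row_ok n t (lookup m) \<rho>)"
proof
  assume "m \<in> (\<lambda>\<alpha>. sqfree (cells n t \<alpha>)) ` choices n t"
  then show "\<forall>\<rho><n. row_ok n t (lookup m) \<rho>" using row_ok_sqfree by blast
next
  assume ok: "\<forall>\<rho><n. row_ok n t (lookup m) \<rho>"
  have "\<exists>c<n. \<forall>a<n. lookup m (\<rho> * n + a) = (if a = c then 1 else 0)" if \<rho>: "\<rho> < n" for \<rho>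
  proof -
    have "(\<Sum>a<n. lookup m (\<rho> * n + a)) = 1" using ok \<rho> by (simp add: row_ok_def)
    then show ?thesis by (subst (asm) sum_eq_1_iff) auto
  qed
  then obtain col where col: "\<And>\<rho>. \<rho> < n \<Longrightarrow> col \<rho> < n"
    "\<And>\<rho> a. \<rho> < n \<Longrightarrow> a < n \<Longrightarrow> lookup m (\<rho> * n + a) = (if a = col \<rho> then 1 else 0)"
    by metis
  \<comment> \<open>The choice is read off in the first row of each band; \<open>band_start\<close>
    carries it to the other rows.\<close>
  define \<alpha> where "\<alpha> = restrict (\<lambda>i. col (i * t)) {..<nblocks n t}"
  have \<alpha>: "\<alpha> \<in> choices n t"
    using col(1) nblocks_mult_less by (auto simp: \<alpha>_def choices_def)
  have "m = sqfree (cells n t \<alpha>)"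
  proof (rule poly_mapping_eqI)
    fix v
    show "lookup m v = lookup (sqfree (cells n t \<alpha>)) v"
    proof (cases "v < n\<^sup>2")
      case True
      define \<rho> a where "\<rho> = v div n" and "a = v mod n"
      have "0 < n" using True by (cases n) auto
      then have v: "v = \<rho> * n + a" "\<rho> < n" "a < n"
        using True by (auto simp: \<rho>_def a_def power2_eq_square less_mult_imp_div_less)
      have i: "\<rho> div t < nblocks n t" by (rule div_less_nblocks[OF v(2)])
      have "lookup m v = lookup m (\<rho> div t * t * n + a)"
        unfolding v(1) using ok by (intro band_start[of n t] v) auto
      also have "\<dots> = (if a = \<alpha> (\<rho> div t) then 1 else 0)"
        using col(2)[OF nblocks_mult_less[OF i] v(3)] i by (simp add: \<alpha>_def)
      finally show ?thesis using cell_in_cells_iff[OF \<alpha> v(2,3)] by (simp add: lookup_sqfree v(1))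
    next
      case False
      then have "v \<notin> keys m" "v \<notin> cells n t \<alpha>" using m cells_subset[OF \<alpha>] by auto
      then show ?thesis by (simp add: lookup_sqfree in_keys_iff)
    qed
  qed
  then show "m \<in> (\<lambda>\<alpha>. sqfree (cells n t \<alpha>)) ` choices n t" using \<alpha> by blast
qed

lemma explicit_band_poly: "explicit_family t (\<lambda>n. band_poly n (t n) :: 'a::field mpoly)"
  unfolding explicit_family_def
proof (rule exI[of _ coeff_prog], rule exI[of _ 7], intro allI impI)
  fix n and m :: monomial
  assume m: "keys m \<subseteq> {..<n\<^sup>2}"
  obtain k r mem where "ram_exec coeff_prog (ram_input n (t n) m) k (r, mem)"
    "k \<le> (n + mono_degree m + 2) ^ 7"
    "r 0 = (if \<forall>\<rho><n. row_ok n (t n) (lookup m) \<rho> then 1 else 0)"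
    using coeff_prog_correct by blast
  then show "\<exists>k r mem. ram_exec coeff_prog (ram_input n (t n) m) k (r, mem) \<and>
      k \<le> (n + mono_degree m + 2) ^ 7 \<and> lookup (band_poly n (t n) :: 'a mpoly) m = of_nat (r 0)"
    by (intro exI[of _ k] exI[of _ r] exI[of _ mem])
      (simp add: lookup_band_poly monomial_iff_rows_ok[OF m])
qed


section \<open>The upper bound\<close>

definition band :: "nat \<Rightarrow> nat \<Rightarrow> nat \<Rightarrow> nat list" where
  "band n t i = filter (\<lambda>\<rho>. \<rho> div t = i) [0..<n]"

definition band_mono :: "nat \<Rightarrow> nat \<Rightarrow> nat \<Rightarrow> nat \<Rightarrow> 'a circuit" where
  "band_mono n t i a = Times (map (\<lambda>\<rho>. Input (\<rho> * n + a)) (band n t i))"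

definition band_sum :: "nat \<Rightarrow> nat \<Rightarrow> nat \<Rightarrow> 'a circuit" where
  "band_sum n t i = Plus (map (band_mono n t i) [0..<n])"

text \<open>Bottom degree \<open>t\<close> allows top fan-in 1, in contrast to the exponential lower
  bound for bottom degree below t/20.\<close>

definition band_circuit :: "nat \<Rightarrow> nat \<Rightarrow> 'a circuit" where
  "band_circuit n t = Plus [Times (map (band_sum n t) [0..<nblocks n t])]"

lemma prod_single_one:
  "(\<Prod>x\<in>A. single (f x) (1::'a::comm_ring_1)) = single (\<Sum>x\<in>A. f x) 1"
  by (induction A rule: infinite_finite_induct) (simp_all add: mult_single)

lemma set_band: "set (band n t i) = {\<rho>. \<rho> < n \<and> \<rho> div t = i}"
  by (auto simp: band_def)

lemma computed_band_mono:
  "computed (band_mono n t i a :: 'a::field circuit) =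
     single (\<Sum>\<rho> | \<rho> < n \<and> \<rho> div t = i. single (\<rho> * n + a) 1) 1"
proof -
  have "computed (band_mono n t i a :: 'a circuit) =
      (\<Prod>\<rho>\<in>set (band n t i). single (single (\<rho> * n + a) 1) 1)"
    by (subst prod.distinct_set_conv_list) (simp_all add: band_mono_def band_def comp_def)
  then show ?thesis by (simp add: prod_single_one set_band)
qed

lemma computed_band_sum:
  "computed (band_sum n t i :: 'a::field circuit) = (\<Sum>a<n. computed (band_mono n t i a))"
  by (simp add: band_sum_def comp_def flip: sum.distinct_set_conv_list[of "[0..<n]"] atLeast0LessThan)

lemma computed_band_circuit: "computed (band_circuit n t) = (band_poly n t :: 'a::field mpoly)"
proof -
  have "computed (band_circuit n t :: 'a circuit) =
      (\<Prod>i<nblocks n t. \<Sum>a<n. computed (band_mono n t i a))"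
    by (simp add: band_circuit_def comp_def computed_band_sum
        flip: prod.distinct_set_conv_list[of "[0..<nblocks n t]"] atLeast0LessThan)
  \<comment> \<open>Expanding the product selects one column in each band, which is exactly an
    element of \<open>choices n t\<close>.\<close>
  also have "\<dots> = (\<Sum>\<alpha>\<in>choices n t. \<Prod>i<nblocks n t. computed (band_mono n t i (\<alpha> i)))"
    unfolding choices_def by (rule prod_sum_PiE) auto
  also have "\<dots> = band_poly n t"
    unfolding band_poly_def
  proof (rule sum.cong[OF refl])
    fix \<alpha> assume \<alpha>: "\<alpha> \<in> choices n t"
    have "sqfree (cells n t \<alpha>) = (\<Sum>\<rho><n. single (\<rho> * n + \<alpha> (\<rho> div t)) 1)"
      unfolding sqfree_def cells_def by (simp add: sum.reindex[OF inj_on_cells_row[OF \<alpha>]])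
    also have "\<dots> = (\<Sum>i<nblocks n t. \<Sum>\<rho> | \<rho> \<in> {..<n} \<and> \<rho> div t = i. single (\<rho> * n + \<alpha> (\<rho> div t)) 1)"
      by (rule sum.group[symmetric]) (auto intro: div_less_nblocks)
    finally show "(\<Prod>i<nblocks n t. computed (band_mono n t i (\<alpha> i))) =
        single (sqfree (cells n t \<alpha>)) (1::'a)"
      by (simp add: computed_band_mono prod_single_one)
  qed
  finally show ?thesis .
qed

lemma length_band:
  assumes "0 < t"
  shows "length (band n t i) \<le> t"
proof -
  have "length (band n t i) = card (set (band n t i))"
    by (rule distinct_card[symmetric]) (simp add: band_def)
  also have "\<dots> \<le> card {i * t..<i * t + t}"
  proof (rule card_mono)
    show "set (band n t i) \<subseteq> {i * t..<i * t + t}"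
    proof
      fix \<rho> assume "\<rho> \<in> set (band n t i)"
      then have "i * t + \<rho> mod t = \<rho>" by (auto simp: set_band)
      then show "\<rho> \<in> {i * t..<i * t + t}" using mod_less_divisor[OF assms, of \<rho>] by auto
    qed
  qed simp
  finally show ?thesis by simp
qed

lemma keys_band_mono:
  "keys (computed (band_mono n t i a :: 'a::field circuit)) \<subseteq> mons UNIV (length (band n t i))"
proof -
  have "keys (prod_list (map (\<lambda>\<rho>. single (single (\<rho> * n + a) 1) (1::'a)) (band n t i))) \<subseteq>
      mons UNIV (sum_list (map (\<lambda>_. 1) (band n t i)))"
    by (rule keys_prod_list_mons) (simp add: mons_def)
  then show ?thesis by (simp add: band_mono_def comp_def sum_list_triv)
qed

text \<open>All columns of a band use the same rows, so its monomials share a degree even in a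
  thinner last band.\<close>

lemma keys_band_sum:
  "keys (computed (band_sum n t i :: 'a::field circuit)) \<subseteq> mons UNIV (length (band n t i))"
  unfolding computed_band_sum by (intro keys_sum_mons keys_band_mono)

lemma homogeneous_band_circuit: "homogeneous_circuit (band_circuit n t :: 'a::field circuit)"
proof -
  let ?T = "Times (map (band_sum n t) [0..<nblocks n t]) :: 'a circuit"
  have T: "computed ?T = band_poly n t"
    using computed_band_circuit[of n t, where 'a = 'a] by (simp add: band_circuit_def)
  have hom: "homogeneous_poly (band_poly n t :: 'a mpoly)"
    by (rule homogeneous_polyI[OF keys_band_poly_mons])
  have inp: "homogeneous_poly (computed (Input v :: 'a circuit))" for v
    by (simp add: homogeneous_poly_def)
  have mono: "homogeneous_poly (computed D)" if "D \<in> nodes (band_mono n t i a)" for D :: "'a circuit" and i a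
    using that inp homogeneous_polyI[OF keys_band_mono[of n t i a, where 'a = 'a]]
    by (auto simp: band_mono_def)
  have sums: "homogeneous_poly (computed D)" if "D \<in> nodes (band_sum n t i)" for D :: "'a circuit" and i
    using that mono homogeneous_polyI[OF keys_band_sum[of n t i, where 'a = 'a]]
    by (auto simp: band_sum_def)
  show ?thesis
    unfolding homogeneous_circuit_def
  proof
    fix D :: "'a circuit" assume "D \<in> nodes (band_circuit n t)"
    then consider "D = band_circuit n t" | "D = ?T" | i where "D \<in> nodes (band_sum n t i)"
      by (auto simp: band_circuit_def)
    then show "homogeneous_poly (computed D)"
      using hom T sums by cases (simp_all add: computed_band_circuit)
  qed
qed

lemma band_circuit_SigmaPiSigmaPi:
  assumes "0 < t"
  shows "(band_circuit n t :: 'a::field circuit) \<in> SigmaPiSigmaPi t"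
proof -
  have "band_mono n t i a \<in> Pi_over leaves" for i a
    by (auto simp: band_mono_def Pi_over_def leaves_def)
  then have "band_sum n t i \<in> SigmaPi" for i
    by (auto simp: band_sum_def SigmaPi_def Sigma_over_def)
  moreover have "total_degree (computed (band_sum n t i :: 'a circuit)) \<le> t" for i
    using total_degree_le[OF keys_band_sum, of n t i] length_band[OF assms] le_trans by blast
  ultimately show ?thesis
    by (auto simp: band_circuit_def SigmaPiSigmaPi_def Sigma_over_def Pi_over_def)
qed

text \<open>At most n bands, n columns and n inputs per monomial give a cubic size; from n = 2 on,
  n^2 absorbs the constant 4.\<close>

lemma size_band_circuit:
  assumes "2 \<le> n"
  shows "circuit_size (band_circuit n t :: 'a circuit) \<le> n ^ 5"
proof -
  have mono: "circuit_size (band_mono n t i a :: 'a circuit) \<le> 1 + n" for i a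
    using length_filter_le[of "\<lambda>\<rho>. \<rho> div t = i" "[0..<n]"]
    by (simp add: band_mono_def comp_def sum_list_triv band_def)
  have sums: "circuit_size (band_sum n t i :: 'a circuit) \<le> 1 + n * (1 + n)" for i
    using sum_list_mono[of "[0..<n]" "\<lambda>a. circuit_size (band_mono n t i a :: 'a circuit)" "\<lambda>_. 1 + n"] mono
    by (simp add: band_sum_def comp_def sum_list_triv)
  have "nblocks n t \<le> n"
  proof -
    have "(n - 1) div t \<le> n - 1" by (rule div_le_dividend)
    then show ?thesis using assms by (auto simp: nblocks_def simp del: div_le_dividend)
  qed
  then have "nblocks n t * (1 + n * (1 + n)) \<le> n * (1 + n * (1 + n))" by (rule mult_right_mono) simp
  moreover have "circuit_size (band_circuit n t :: 'a circuit) \<le> 2 + nblocks n t * (1 + n * (1 + n))"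
    using sum_list_mono[of "[0..<nblocks n t]" "\<lambda>i. circuit_size (band_sum n t i :: 'a circuit)"
        "\<lambda>_. 1 + n * (1 + n)"] sums
    by (simp add: band_circuit_def comp_def sum_list_triv)
  ultimately have "circuit_size (band_circuit n t :: 'a circuit) \<le> 2 + n * (1 + n * (1 + n))" by linarith
  also have "\<dots> = 2 + n + n ^ 2 + n ^ 3" by (simp add: algebra_simps eval_nat_numeral)
  also have "\<dots> \<le> 4 * n ^ 3"
  proof -
    have "n \<le> n ^ 3" "n ^ 2 \<le> n ^ 3" using assms by (simp_all add: self_le_power power_increasing)
    then show ?thesis using assms by linarith
  qed
  also have "\<dots> \<le> n ^ 2 * n ^ 3" using power_mono[OF assms, of 2] by (intro mult_right_mono) simp_all
  also have "\<dots> = n ^ 5" by (simp flip: power_add)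
  finally show ?thesis .
qed


section \<open>Decomposing a circuit\<close>

text \<open>Greedy merging: a new factor is multiplied into the head if the head has degree below
  \<open>s\<close>, and otherwise becomes the new head. Degrees stay at most 2 s and only the head
  can be below \<open>s\<close>, which bounds the number of factors.\<close>

lemma merge_factors:
  fixes qs :: "('a::field mpoly \<times> nat) list"
  assumes "\<And>q. q \<in> set qs \<Longrightarrow> keys (fst q) \<subseteq> mons V (snd q) \<and> snd q \<le> s"
  shows "\<exists>ps. prod_list (map fst ps) = prod_list (map fst qs) \<and>
     sum_list (map snd ps) = sum_list (map snd qs) \<and>
     (\<forall>p\<in>set ps. keys (fst p) \<subseteq> mons V (snd p) \<and> snd p \<le> 2 * s) \<and> (\<forall>p\<in>set (tl ps). s \<le> snd p)"
  using assms
proof (induction qs)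
  case Nil
  then show ?case by (intro exI[of _ "[]"]) simp
next
  case (Cons q qs)
  from Cons.IH[OF Cons.prems] obtain ps where
    ps: "prod_list (map fst ps) = prod_list (map fst qs)" "sum_list (map snd ps) = sum_list (map snd qs)"
    "\<And>p. p \<in> set ps \<Longrightarrow> keys (fst p) \<subseteq> mons V (snd p) \<and> snd p \<le> 2 * s"
    "\<And>p. p \<in> set (tl ps) \<Longrightarrow> s \<le> snd p"
    by auto
  have q: "keys (fst q) \<subseteq> mons V (snd q)" "snd q \<le> s" using Cons.prems[of q] by auto
  show ?case
  proof (cases ps)
    case Nil
    then show ?thesis using ps(1,2) q by (intro exI[of _ "[q]"]) auto
  next
    case (Cons p ps')
    show ?thesis
    proof (cases "snd p < s")
      case True
      have "keys (fst q * fst p) \<subseteq> mons V (snd q + snd p)"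
        using keys_mult_mons[OF q(1)] ps(3)[of p] Cons by simp
      then show ?thesis
        using ps q True unfolding Cons
        by (intro exI[of _ "(fst q * fst p, snd q + snd p) # ps'"]) (auto simp: mult.assoc simp flip: ps(1,2))
    next
      case False
      then show ?thesis
        using ps q unfolding Cons
        by (intro exI[of _ "q # p # ps'"]) (auto simp flip: ps(1,2))
    qed
  qed
qed

lemma length_le_of_tl_ge:
  fixes ps :: "('b \<times> nat) list"
  assumes "\<And>p. p \<in> set (tl ps) \<Longrightarrow> s \<le> snd p"
  shows "length ps * s \<le> sum_list (map snd ps) + s"
proof (cases ps)
  case (Cons p ps')
  have "sum_list (map (\<lambda>_. s) ps') \<le> sum_list (map snd ps')"
    by (rule sum_list_mono) (use assms Cons in auto)
  then show ?thesis using Cons by (simp add: sum_list_triv)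
qed simp

lemma finite_nodes: "finite (nodes C)"
  by (induction C) auto

lemma self_in_nodes: "C \<in> nodes C"
  by (cases C) auto

lemma finite_vars: "finite (vars p)"
  by (simp add: vars_def)

lemma lookup_sum_list: "lookup (sum_list ps) m = sum_list (map (\<lambda>p. lookup p m) ps)"
  by (induction ps) (auto simp: lookup_add)

lemma homogeneous_poly_keys:
  assumes "homogeneous_poly p" "vars p \<subseteq> V"
  shows "keys p \<subseteq> mons V (total_degree p)"
proof (cases "p = 0")
  case False
  from assms(1) obtain d where d: "\<forall>m\<in>keys p. mono_degree m = d"
    unfolding homogeneous_poly_def by blast
  then have "keys p \<subseteq> mons V d" using assms(2) by (auto simp: mons_def vars_def)
  with total_degree_eq[OF this False] show ?thesis by simp
qed simp

definition normal_term :: "nat set \<Rightarrow> nat \<Rightarrow> nat \<Rightarrow> ('a::field mpoly \<times> nat) list \<Rightarrow> bool" where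
  "normal_term V n s ps \<longleftrightarrow> length ps * s \<le> n + s \<and> sum_list (map snd ps) = n \<and>
     (\<forall>p\<in>set ps. keys (fst p) \<subseteq> mons V (snd p) \<and> snd p \<le> 2 * s)"

text \<open>A nonzero homogeneous polynomial has only one degree, so the recorded degrees of the
  merged factors must add up to \<open>n\<close>.\<close>

lemma normal_term_of_product:
  fixes qs :: "'a::field circuit list"
  assumes hom: "\<And>q. q \<in> set qs \<Longrightarrow> homogeneous_poly (computed q) \<and>
      total_degree (computed q) \<le> s \<and> vars (computed q) \<subseteq> V"
    and n: "keys (computed (Times qs)) \<subseteq> mons UNIV n" and nz: "computed (Times qs) \<noteq> 0"
  shows "\<exists>ps. normal_term V n s ps \<and> prod_list (map fst ps) = computed (Times qs)"
proof -
  let ?f = "\<lambda>q. (computed q, total_degree (computed q))"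
  have "\<exists>ps. prod_list (map fst ps) = prod_list (map fst (map ?f qs)) \<and>
     sum_list (map snd ps) = sum_list (map snd (map ?f qs)) \<and>
     (\<forall>p\<in>set ps. keys (fst p) \<subseteq> mons V (snd p) \<and> snd p \<le> 2 * s) \<and> (\<forall>p\<in>set (tl ps). s \<le> snd p)"
  proof (rule merge_factors)
    fix p assume "p \<in> set (map ?f qs)"
    then obtain q where "q \<in> set qs" "p = ?f q" by auto
    then show "keys (fst p) \<subseteq> mons V (snd p) \<and> snd p \<le> s"
      using hom[of q] homogeneous_poly_keys[of "computed q" V] by simp
  qed
  then obtain ps where ps: "prod_list (map fst ps) = computed (Times qs)"
    "\<forall>p\<in>set ps. keys (fst p) \<subseteq> mons V (snd p) \<and> snd p \<le> 2 * s" "\<forall>p\<in>set (tl ps). s \<le> snd p"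
    by (auto simp: comp_def)
  have "keys (prod_list (map fst ps)) \<subseteq> mons V (sum_list (map snd ps))"
    by (rule keys_prod_list_mons) (use ps(2) in auto)
  then have "total_degree (computed (Times qs)) = sum_list (map snd ps)"
    using total_degree_eq nz ps(1) by metis
  moreover have "total_degree (computed (Times qs)) = n" by (rule total_degree_eq[OF n nz])
  ultimately have "sum_list (map snd ps) = n" by simp
  then show ?thesis
    using ps length_le_of_tl_ge[of ps s] unfolding normal_term_def by auto
qed

lemma circuit_decomposition:
  fixes C :: "'a::field circuit"
  assumes C: "C \<in> SigmaPiSigmaPi t'" "homogeneous_circuit C" and n: "keys (computed C) \<subseteq> mons UNIV n"
    and s: "t' \<le> s"
  shows "\<exists>V Ts. finite V \<and> length Ts \<le> top_fan_in C \<and>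
     computed C = (\<Sum>ps\<leftarrow>Ts. prod_list (map fst ps)) \<and> (\<forall>ps\<in>set Ts. normal_term V n s ps)"
proof -
  \<comment> \<open>Gates may use variables that cancel in the output, so \<open>V\<close> collects
    the variables of all gates.\<close>
  define V where "V = (\<Union>D\<in>nodes C. vars (computed D))"
  obtain cs where cs: "C = Plus cs"
    "set cs \<subseteq> Pi_over {Q \<in> SigmaPi. total_degree (computed Q) \<le> t'}"
    using C(1) unfolding SigmaPiSigmaPi_def Sigma_over_def by blast
  \<comment> \<open>Homogeneous products of a degree other than \<open>n\<close> must cancel among
    themselves; they and the zero products are dropped, which can only lower the fan-in.\<close>
  define good where "good c \<longleftrightarrow> computed c \<noteq> 0 \<and> keys (computed c) \<subseteq> mons UNIV n" for c :: "'a circuit"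
  have "\<exists>ps. normal_term V n s ps \<and> prod_list (map fst ps) = computed c"
    if c: "c \<in> set cs" "good c" for c
  proof -
    obtain qs where qs: "c = Times qs" "set qs \<subseteq> {Q \<in> SigmaPi. total_degree (computed Q) \<le> t'}"
      using c cs(2) unfolding Pi_over_def by blast
    have "q \<in> nodes C" if "q \<in> set qs" for q
    proof -
      have "q \<in> nodes c" using that self_in_nodes[of q] by (auto simp: qs(1))
      then show ?thesis using c(1) unfolding cs(1) nodes.simps by blast
    qed
    then show ?thesis
      unfolding qs(1)
      by (intro normal_term_of_product)
        (use c(2) qs C(2) s in \<open>auto simp: good_def V_def homogeneous_circuit_def\<close>)
  qed
  then obtain ps where ps: "\<And>c. c \<in> set cs \<Longrightarrow> good c \<Longrightarrow>
      normal_term V n s (ps c) \<and> prod_list (map fst (ps c)) = computed c"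
    by metis
  define Ts where "Ts = map ps (filter good cs)"
  have "computed C = sum_list (map computed (filter good cs))"
  proof (rule poly_mapping_eqI)
    fix m
    have "(\<Sum>c\<leftarrow>filter good cs. lookup (computed c) m) = lookup (computed C) m"
    proof (cases "mono_degree m = n")
      case True
      have "(\<Sum>c\<leftarrow>filter good cs. lookup (computed c) m) = (\<Sum>c\<leftarrow>cs. lookup (computed c) m)"
      proof (rule sum_list_map_filter)
        fix c assume c: "c \<in> set cs" "\<not> good c"
        have "c \<in> nodes C" using c self_in_nodes unfolding cs(1) by auto
        then obtain d where d: "\<forall>m\<in>keys (computed c). mono_degree m = d"
          using C(2) unfolding homogeneous_circuit_def homogeneous_poly_def by blast
        show "lookup (computed c) m = 0"
        proof (rule ccontr)
          assume "lookup (computed c) m \<noteq> 0"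
          then have m: "m \<in> keys (computed c)" by (simp add: in_keys_iff)
          then have "mono_degree m = d" using d by blast
          then have "d = n" using True by simp
          then have "keys (computed c) \<subseteq> mons UNIV n" using d unfolding mons_def by blast
          then show False using c(2) m unfolding good_def by auto
        qed
      qed
      then show ?thesis by (simp add: cs(1) lookup_sum_list comp_def)
    next
      case False
      have "lookup (computed c) m = 0" if "good c" for c
        using that False unfolding good_def mons_def by (auto simp: in_keys_iff)
      then have "(\<Sum>c\<leftarrow>filter good cs. lookup (computed c) m) = (\<Sum>c\<leftarrow>filter good cs. 0)"
        by (intro arg_cong[where f = sum_list] map_cong) auto
      moreover have "lookup (computed C) m = 0"
        using n False unfolding mons_def by (auto simp: in_keys_iff)
      ultimately show ?thesis by (simp only: sum_list_0)
    qed
    then show "lookup (computed C) m = lookup (sum_list (map computed (filter good cs))) m"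
      by (simp add: lookup_sum_list comp_def)
  qed
  moreover have "map (\<lambda>ps. prod_list (map fst ps)) Ts = map computed (filter good cs)"
    unfolding Ts_def using ps by auto
  ultimately have "computed C = (\<Sum>ps\<leftarrow>Ts. prod_list (map fst ps))" by simp
  moreover have "finite V" by (simp add: V_def finite_nodes finite_vars)
  moreover have "length Ts \<le> top_fan_in C" by (simp add: Ts_def cs(1))
  moreover have "\<forall>ps\<in>set Ts. normal_term V n s ps" unfolding Ts_def using ps by auto
  ultimately show ?thesis by blast
qed


section \<open>The lower bound\<close>

text \<open>Differentiating by the selected variable in the first row of every band isolates one
  monomial of the family.\<close>

definition diff_vars :: "nat \<Rightarrow> nat \<Rightarrow> (nat \<Rightarrow> nat) \<Rightarrow> nat list" where
  "diff_vars n t \<alpha> = map (\<lambda>i. i * t * n + \<alpha> i) [0..<nblocks n t]"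

definition rest_cells :: "nat \<Rightarrow> nat \<Rightarrow> (nat \<Rightarrow> nat) \<Rightarrow> nat set" where
  "rest_cells n t \<alpha> = cells n t \<alpha> - set (diff_vars n t \<alpha>)"

text \<open>The last band may be too thin to separate monomials, so its choice is fixed.\<close>

definition free_choices :: "nat \<Rightarrow> nat \<Rightarrow> (nat \<Rightarrow> nat) set" where
  "free_choices n t = (\<Pi>\<^sub>E i\<in>{..<nblocks n t}. if i < n div t then {..<n} else {0})"

lemma choices_lessI: "\<alpha> \<in> choices n t \<Longrightarrow> i < nblocks n t \<Longrightarrow> \<alpha> i < n"
  by (auto simp: choices_def)

text \<open>The variables record the chosen column of every band and hence the whole choice. This is
  why the derivative kills all other monomials.\<close>

lemma diff_vars_subset_iff:
  assumes \<alpha>: "\<alpha> \<in> choices n t" and \<beta>: "\<beta> \<in> choices n t"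
  shows "set (diff_vars n t \<alpha>) \<subseteq> cells n t \<beta> \<longleftrightarrow> \<alpha> = \<beta>"
proof -
  have "i * t * n + \<alpha> i \<in> cells n t \<beta> \<longleftrightarrow> \<alpha> i = \<beta> i" if i: "i < nblocks n t" for i
    using cell_in_cells_iff[OF \<beta> nblocks_mult_less[OF i] choices_lessI[OF \<alpha> i]]
    by (simp add: nblocks_mult_div[OF i])
  then have "set (diff_vars n t \<alpha>) \<subseteq> cells n t \<beta> \<longleftrightarrow> (\<forall>i<nblocks n t. \<alpha> i = \<beta> i)"
    by (simp add: diff_vars_def image_subset_iff Ball_def)
  also have "\<dots> \<longleftrightarrow> \<alpha> = \<beta>"
    using \<alpha> \<beta> unfolding choices_def by (auto intro: PiE_ext)
  finally show ?thesis .
qed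

lemma distinct_diff_vars:
  assumes "\<alpha> \<in> choices n t"
  shows "distinct (diff_vars n t \<alpha>)"
proof -
  have "inj_on (\<lambda>i. i * t * n + \<alpha> i) {0..<nblocks n t}"
  proof (rule inj_onI)
    fix i j assume ij: "i \<in> {0..<nblocks n t}" "j \<in> {0..<nblocks n t}"
      "i * t * n + \<alpha> i = j * t * n + \<alpha> j"
    then have "i * t = j * t"
      using cell_eq_iff[of "\<alpha> i" n "\<alpha> j" "i * t" "j * t"] choices_lessI[OF assms] by simp
    then show "i = j" using nblocks_mult_div ij(1,2) by (metis atLeastLessThan_iff)
  qed
  then show ?thesis by (simp add: diff_vars_def distinct_map)
qed

lemma pds_band_poly:
  assumes \<alpha>: "\<alpha> \<in> choices n t"
  shows "pds (diff_vars n t \<alpha>) (band_poly n t) = single (sqfree (rest_cells n t \<alpha>)) (1::'a::field)"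
proof -
  have "pds (diff_vars n t \<alpha>) (band_poly n t :: 'a mpoly) =
    (\<Sum>\<beta>\<in>choices n t. if \<alpha> = \<beta> then single (sqfree (cells n t \<beta> - set (diff_vars n t \<alpha>))) 1 else 0)"
    unfolding band_poly_def pds_sum
    by (rule sum.cong) (simp_all add: pds_sqfree distinct_diff_vars[OF \<alpha>] diff_vars_subset_iff[OF \<alpha>])
  then show ?thesis using \<alpha> by (simp add: finite_choices rest_cells_def)
qed

lemma card_rest_cells:
  assumes "\<alpha> \<in> choices n t"
  shows "card (rest_cells n t \<alpha>) + nblocks n t = n"
proof -
  have sub: "set (diff_vars n t \<alpha>) \<subseteq> cells n t \<alpha>"
    using diff_vars_subset_iff[OF assms assms] by simp
  have "card (set (diff_vars n t \<alpha>)) = nblocks n t"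
    using distinct_card[OF distinct_diff_vars[OF assms]] by (simp add: diff_vars_def)
  then show ?thesis
    using card_Diff_subset[OF _ sub] card_mono[OF _ sub] card_cells[OF assms]
    by (simp add: rest_cells_def)
qed

text \<open>In a full band where the choices differ, no cell of \<open>\<beta>\<close> lies in
  \<open>cells n t \<alpha>\<close>. Differentiation removes the cell in the first row, which leaves
  t - 1 new ones.\<close>

lemma card_rest_cells_Un:
  assumes \<alpha>: "\<alpha> \<in> choices n t" and \<beta>: "\<beta> \<in> choices n t"
  shows "card (rest_cells n t \<alpha>) + (t - 1) * card {i. i < n div t \<and> \<alpha> i \<noteq> \<beta> i} \<le>
           card (rest_cells n t \<alpha> \<union> rest_cells n t \<beta>)"
proof -
  let ?I = "{i. i < n div t \<and> \<alpha> i \<noteq> \<beta> i}"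
  let ?g = "\<lambda>(i, j). (i * t + j) * n + \<beta> i"
  have row: "i * t + j < n" "(i * t + j) div t = i" "(i * t + j) mod t = j" "\<beta> i < n"
    if "i < n div t" "j < t" for i j
  proof -
    have "i * t + j < Suc i * t" using that by simp
    also have "\<dots> \<le> n div t * t" using that by (intro mult_right_mono) auto
    also have "\<dots> \<le> n" by simp
    finally show *: "i * t + j < n" .
    show **: "(i * t + j) div t = i" "(i * t + j) mod t = j" using that by auto
    show "\<beta> i < n" using choices_less[OF \<beta> *] by (simp only: **)
  qed
  have "inj_on ?g (?I \<times> {1..<t})"
  proof (rule inj_onI, clarify)
    fix i j i' j' assume *: "i < n div t" "i' < n div t" "j \<in> {1..<t}" "j' \<in> {1..<t}"
      "(i * t + j) * n + \<beta> i = (i' * t + j') * n + \<beta> i'"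
    then have "i * t + j = i' * t + j'"
      using cell_eq_iff[of "\<beta> i" n "\<beta> i'" "i * t + j" "i' * t + j'"] row(4) by auto
    then show "i = i' \<and> j = j'"
      using row(2,3)[of i j] row(2,3)[of i' j'] * by auto
  qed
  then have "(t - 1) * card ?I = card (?g ` (?I \<times> {1..<t}))"
    by (simp add: card_image mult.commute)
  also have "\<dots> \<le> card (rest_cells n t \<beta> - rest_cells n t \<alpha>)"
  proof (rule card_mono)
    show "?g ` (?I \<times> {1..<t}) \<subseteq> rest_cells n t \<beta> - rest_cells n t \<alpha>"
    proof clarify
      fix i j assume i: "i < n div t" "\<alpha> i \<noteq> \<beta> i" and j: "j \<in> {1..<t}"
      note r = row[of i j, OF i(1)]
      have jt: "j < t" using j by simp
      have "(i * t + j) * n + \<beta> i \<in> cells n t \<beta>"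
        using cell_in_cells_iff[OF \<beta> r(1) r(4)] r(2) jt by simp
      moreover have "(i * t + j) * n + \<beta> i \<notin> cells n t \<alpha>"
        using cell_in_cells_iff[OF \<alpha> r(1) r(4)] r(2) jt i(2) by simp
      moreover have "(i * t + j) * n + \<beta> i \<notin> set (diff_vars n t \<beta>)"
      proof
        assume "(i * t + j) * n + \<beta> i \<in> set (diff_vars n t \<beta>)"
        then obtain i' where i': "i' < nblocks n t" "(i * t + j) * n + \<beta> i = i' * t * n + \<beta> i'"
          by (auto simp: diff_vars_def)
        then have "i * t + j = i' * t"
          using cell_eq_iff[OF r(4) choices_lessI[OF \<beta> i'(1)]] jt by blast
        then show False using r(3) jt j by (metis atLeastLessThan_iff mod_mult_self2_is_0 not_one_le_zero)
      qed
      ultimately show "(i * t + j) * n + \<beta> i \<in> rest_cells n t \<beta> - rest_cells n t \<alpha>"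
        by (simp add: rest_cells_def)
    qed
  qed (simp add: rest_cells_def)
  also have "card (rest_cells n t \<alpha>) + \<dots> = card (rest_cells n t \<alpha> \<union> rest_cells n t \<beta>)"
    using card_Un_disjoint[of "rest_cells n t \<alpha>" "rest_cells n t \<beta> - rest_cells n t \<alpha>"]
    by (simp add: rest_cells_def)
  finally show ?thesis by simp
qed

lemma div_le_nblocks: "n div t \<le> nblocks n t"
proof (cases "n = 0 \<or> t = 0")
  case False
  have "(n - 1 + t) div t = (n - 1) div t + 1" by (rule div_add_self2) (use False in simp)
  moreover have "n div t \<le> (n - 1 + t) div t" using False by (intro div_le_mono) linarith
  ultimately show ?thesis using False by (simp add: nblocks_def)
qed (auto simp: nblocks_def)

lemma free_choices_subset: "0 < n \<Longrightarrow> free_choices n t \<subseteq> choices n t"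
  unfolding free_choices_def choices_def by (rule PiE_mono) auto

lemma card_free_choices: "card (free_choices n t) = n ^ (n div t)"
proof -
  have "card (free_choices n t) = (\<Prod>i<nblocks n t. if i < n div t then n else 1)"
    unfolding free_choices_def by (subst card_PiE) (auto intro: prod.cong)
  also have "\<dots> = (\<Prod>i\<in>{i \<in> {..<nblocks n t}. i < n div t}. n)"
    by (rule prod.inter_filter[symmetric]) simp
  also have "{i \<in> {..<nblocks n t}. i < n div t} = {..<n div t}"
    using div_le_nblocks[of n t] by auto
  finally show ?thesis by simp
qed

text \<open>A Hamming distance enumerator, which factors over the bands: a free band gives 1 + (n -
  1) w and a fixed one gives 1.\<close>

lemma sum_distances:
  fixes w :: real
  assumes \<alpha>: "\<alpha> \<in> free_choices n t" and w: "0 \<le> w"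
  shows "(\<Sum>\<beta>\<in>free_choices n t. w ^ card {i. i < n div t \<and> \<alpha> i \<noteq> \<beta> i}) \<le> (1 + n * w) ^ nblocks n t"
proof -
  let ?F = "\<lambda>i. if i < n div t then {..<n} else {0::nat}"
  have "(\<Sum>\<beta>\<in>free_choices n t. w ^ card {i. i < n div t \<and> \<alpha> i \<noteq> \<beta> i}) =
        (\<Sum>\<beta>\<in>free_choices n t. \<Prod>i<nblocks n t. if \<alpha> i \<noteq> \<beta> i then w else 1)"
  proof (rule sum.cong[OF refl])
    fix \<beta> assume \<beta>: "\<beta> \<in> free_choices n t"
    have "{i \<in> {..<nblocks n t}. \<alpha> i \<noteq> \<beta> i} = {i. i < n div t \<and> \<alpha> i \<noteq> \<beta> i}"
    proof -
      have "\<alpha> i = \<beta> i" if "i < nblocks n t" "\<not> i < n div t" for i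
        using \<alpha> \<beta> that unfolding free_choices_def by (auto dest!: PiE_mem[of _ _ _ i])
      then show ?thesis using div_le_nblocks[of n t] by fastforce
    qed
    then show "w ^ card {i. i < n div t \<and> \<alpha> i \<noteq> \<beta> i} =
        (\<Prod>i<nblocks n t. if \<alpha> i \<noteq> \<beta> i then w else 1)"
      by (simp flip: prod.inter_filter)
  qed
  also have "\<dots> = (\<Prod>i<nblocks n t. \<Sum>y\<in>?F i. if \<alpha> i \<noteq> y then w else 1)"
    unfolding free_choices_def by (rule prod_sum_PiE[symmetric]) auto
  also have "\<dots> \<le> (\<Prod>i<nblocks n t. 1 + n * w)"
  proof (rule prod_mono)
    fix i assume i: "i \<in> {..<nblocks n t}"
    have \<alpha>i: "\<alpha> i \<in> ?F i" using \<alpha> i unfolding free_choices_def by (auto dest!: PiE_mem[of _ _ _ i])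
    have "(\<Sum>y\<in>?F i. if \<alpha> i \<noteq> y then w else 1) = 1 + (\<Sum>y\<in>?F i - {\<alpha> i}. if \<alpha> i \<noteq> y then w else 1)"
      by (subst sum.remove[OF _ \<alpha>i]) auto
    also have "(\<Sum>y\<in>?F i - {\<alpha> i}. if \<alpha> i \<noteq> y then w else 1) = card (?F i - {\<alpha> i}) * w"
      by (subst sum.cong[OF refl, of _ _ "\<lambda>_. w"]) auto
    also have "\<dots> \<le> n * w"
    proof (rule mult_right_mono[OF _ w])
      have "card (?F i - {\<alpha> i}) \<le> n" using \<alpha>i by (auto simp: card_Diff_singleton_if)
      then show "real (card (?F i - {\<alpha> i})) \<le> real n" by simp
    qed
    finally have "(\<Sum>y\<in>?F i. if \<alpha> i \<noteq> y then w else 1) \<le> 1 + n * w" by simp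
    moreover have "0 \<le> (\<Sum>y\<in>?F i. if \<alpha> i \<noteq> y then w else 1)"
      by (rule sum_nonneg) (use w in simp)
    ultimately show "0 \<le> (\<Sum>y\<in>?F i. if \<alpha> i \<noteq> y then w else 1) \<and>
        (\<Sum>y\<in>?F i. if \<alpha> i \<noteq> y then w else 1) \<le> 1 + n * w" by blast
  qed
  finally show ?thesis by simp
qed

text \<open>This is \<open>shifted_partials_bound\<close> with one derivative per band and E = 2 s.
  The last condition on \<open>z\<close> makes overlaps cost at most half of each
  \<open>z ^ D\<close>, which adds one to the exponent of 2.\<close>

lemma top_fan_in_bound:
  fixes C :: "'a::field circuit" and z :: real
  assumes C: "C \<in> SigmaPiSigmaPi t'" "homogeneous_circuit C" "computed C = band_poly n t"
    and s: "t' \<le> s" "0 < s" and n: "0 < n"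
    and z: "0 < z" "z < 1" "(1 + n * z ^ (t - 1)) ^ nblocks n t \<le> 3 / 2"
  shows "real n ^ (n div t) * z ^ (nblocks n t * (2 * s)) \<le>
           real (top_fan_in C) * 2 ^ (n div s + 2)"
proof -
  let ?B = "nblocks n t" and ?A = "free_choices n t" and ?S = "rest_cells n t"
  have keysC: "keys (computed C) \<subseteq> mons UNIV n"
    using keys_band_poly_mons[of n t, where 'a = 'a] by (auto simp: C(3) mons_def)
  obtain V0 Ts where V0: "finite V0" and len: "length Ts \<le> top_fan_in C"
    and sum: "computed C = (\<Sum>ps\<leftarrow>Ts. prod_list (map fst ps))"
    and normal: "\<And>ps. ps \<in> set Ts \<Longrightarrow> normal_term V0 n s ps"
    using circuit_decomposition[OF C(1,2) keysC s(1)] by metis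
  define V where "V = V0 \<union> {..<n\<^sup>2}"
  define T where "T = length Ts"
  have normalT: "normal_term V0 n s (Ts ! r)" if "r < T" for r
    using that normal by (simp add: T_def)
  have A: "finite ?A" by (simp add: free_choices_def finite_PiE)
  have AB: "\<alpha> \<in> choices n t" if "\<alpha> \<in> ?A" for \<alpha> using that free_choices_subset[OF n] by blast
  define D where "D = n - ?B"
  have Bn: "?B \<le> n" using card_rest_cells choices_nonempty[of n t] by (metis all_not_in_conv le_add2)
  have DB: "D + ?B = n" using Bn by (simp add: D_def)
  have cardS: "card (?S \<alpha>) = D" if "\<alpha> \<in> choices n t" for \<alpha>
    using card_rest_cells[OF that] by (simp add: D_def)
  have "(\<Sum>a\<in>?A. z ^ D - (\<Sum>b\<in>?A - {a}. z ^ card (?S a \<union> ?S b))) \<le>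
      real T * 2 ^ (n div s + 1) * z ^ (D + ?B - ?B * (2 * s))"
  proof (rule shifted_partials_bound[where P = "band_poly n t :: 'a mpoly" and V = V and S = ?S
        and W = "diff_vars n t"
        and J = "\<lambda>r. {0..<length (Ts ! r)}" and R = "\<lambda>r j. fst (Ts ! r ! j)"
        and e = "\<lambda>r j. snd (Ts ! r ! j)"])
    show "finite V" using V0 by (simp add: V_def)
    show "(band_poly n t :: 'a mpoly) = (\<Sum>r<T. \<Prod>j\<in>{0..<length (Ts ! r)}. fst (Ts ! r ! j))"
      unfolding C(3)[symmetric] sum
      by (simp add: sum_list_sum_nth prod.list_conv_set_nth T_def atLeast0LessThan)
    fix r assume r: "r < T"
    show "card {0..<length (Ts ! r)} \<le> n div s + 1"
    proof -
      have "length (Ts ! r) * s \<le> n + s" using normalT[OF r] by (simp add: normal_term_def)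
      then have "length (Ts ! r) \<le> (n + s) div s"
        using s(2) by (subst less_eq_div_iff_mult_less_eq) simp_all
      then show ?thesis using s(2) by simp
    qed
    show "(\<Sum>j\<in>{0..<length (Ts ! r)}. snd (Ts ! r ! j)) = D + ?B"
      using normalT[OF r] by (simp add: DB normal_term_def sum_list_sum_nth)
    fix j assume "j \<in> {0..<length (Ts ! r)}"
    then have "keys (fst (Ts ! r ! j)) \<subseteq> mons V0 (snd (Ts ! r ! j)) \<and> snd (Ts ! r ! j) \<le> 2 * s"
      using normalT[OF r] by (simp add: normal_term_def)
    then show "keys (fst (Ts ! r ! j)) \<subseteq> mons V (snd (Ts ! r ! j))" "snd (Ts ! r ! j) \<le> 2 * s"
      by (auto simp: mons_def V_def)
  next
    fix a assume a: "a \<in> ?A"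
    show "?S a \<subseteq> V" using cells_subset[OF AB[OF a]] by (auto simp: rest_cells_def V_def)
    show "length (diff_vars n t a) = ?B" by (simp add: diff_vars_def)
    show "pds (diff_vars n t a) (band_poly n t) = single (sqfree (?S a)) (1::'a)"
      by (rule pds_band_poly[OF AB[OF a]])
  qed (use z A cardS AB in auto)
  moreover have "z ^ D / 2 \<le> z ^ D - (\<Sum>b\<in>?A - {a}. z ^ card (?S a \<union> ?S b))" if a: "a \<in> ?A" for a
  proof -
    let ?h = "\<lambda>b. card {i. i < n div t \<and> a i \<noteq> b i}"
    have "(\<Sum>b\<in>?A - {a}. z ^ card (?S a \<union> ?S b)) \<le> (\<Sum>b\<in>?A - {a}. z ^ D * (z ^ (t - 1)) ^ ?h b)"
    proof (rule sum_mono)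
      fix b assume b: "b \<in> ?A - {a}"
      have "z ^ card (?S a \<union> ?S b) \<le> z ^ (D + (t - 1) * ?h b)"
        using card_rest_cells_Un[of a n t b] cardS AB a b z by (intro power_decreasing) auto
      then show "z ^ card (?S a \<union> ?S b) \<le> z ^ D * (z ^ (t - 1)) ^ ?h b"
        by (simp add: power_add power_mult)
    qed
    \<comment> \<open>The missing term \<open>b = a\<close> has distance 0 and equals 1; removing it
      leaves 3/2 - 1 = 1/2.\<close>
    also have "\<dots> = z ^ D * ((\<Sum>b\<in>?A. (z ^ (t - 1)) ^ ?h b) - 1)"
      using A a by (simp add: sum_distrib_left sum_diff1 right_diff_distrib)
    also have "\<dots> \<le> z ^ D * (1 / 2)"
      using sum_distances[OF a, of "z ^ (t - 1)"] z by (intro mult_left_mono) auto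
    finally show ?thesis by simp
  qed
  ultimately have "(\<Sum>a\<in>?A. z ^ D / 2) \<le> real T * 2 ^ (n div s + 1) * z ^ (D + ?B - ?B * (2 * s))"
    using sum_mono[of ?A "\<lambda>_. z ^ D / 2"] by (meson order_trans)
  \<comment> \<open>Multiplying by this power undoes the truncated subtraction: the resulting
    exponent on the right is at least \<open>D\<close> in any case.\<close>
  then have "real n ^ (n div t) * z ^ D / 2 * z ^ (?B * (2 * s)) \<le>
      real T * 2 ^ (n div s + 1) * z ^ (D + ?B - ?B * (2 * s)) * z ^ (?B * (2 * s))"
    using z by (intro mult_right_mono) (simp_all add: card_free_choices)
  also have "\<dots> = real T * 2 ^ (n div s + 1) * z ^ (D + ?B - ?B * (2 * s) + ?B * (2 * s))"
    by (simp add: power_add)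
  also have "\<dots> \<le> real (top_fan_in C) * 2 ^ (n div s + 1) * z ^ D"
  proof (rule mult_mono)
    show "z ^ (D + ?B - ?B * (2 * s) + ?B * (2 * s)) \<le> z ^ D"
      using z by (intro power_decreasing) auto
  qed (use z len in \<open>auto simp: T_def intro: mult_right_mono\<close>)
  finally have "(real n ^ (n div t) * z ^ (?B * (2 * s))) * z ^ D \<le>
      (real (top_fan_in C) * 2 ^ (n div s + 2)) * z ^ D"
    by (simp add: mult_ac)
  then show ?thesis using z by simp
qed

section \<open>Numerical estimates for the chosen parameters\<close>

lemma band_lower_bound:
  fixes C :: "'a::field circuit"
  assumes C: "C \<in> SigmaPiSigmaPi t'" "homogeneous_circuit C" "computed C = band_poly n t"
    and t': "real t' < real t / 20" and t: "40 \<le> t" "real t \<le> 1 / 10 * real n" and n: "164 \<le> ln (real n)"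
  shows "exp (1 / 8 * (real n / real t * ln (real (n\<^sup>2)))) \<le> real (top_fan_in C)"
proof -
  \<comment> \<open>Merging at scale \<open>s\<close> rather than \<open>t'\<close> keeps the number
    of factors O(n/t) even when \<open>t'\<close> is tiny.\<close>
  define s where "s = t div 20"
  define L where "L = ln (real n)"
  define y where "y = real n / real t"
  \<comment> \<open>Chosen so that \<open>n * z ^ (t - 1)\<close> is 1/n^2, which over at most n
    bands still sums to at most 1/n.\<close>
  define z where "z = exp (- (3 * L / real (t - 1)))"
  let ?B = "nblocks n t"
  have n400: "400 \<le> real n" using t by linarith
  then have n0: "0 < n" by linarith
  have L: "real n = exp L" "164 \<le> L" using n n0 by (simp_all add: L_def)
  have z: "0 < z" "z < 1" using L t by (simp_all add: z_def)
  have zt: "z ^ (t - 1) = exp (- 3 * L)"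
    using t by (simp add: z_def flip: exp_of_nat_mult)
  have s: "t' \<le> s" "0 < s" "real t \<le> 40 * real s" "20 * s \<le> t"
  proof -
    show "t' \<le> s" using t' by (simp add: s_def less_eq_div_iff_mult_less_eq)
    show "0 < s" using t by (simp add: s_def div_greater_zero_iff)
    have "t \<le> 40 * s" using t unfolding s_def by linarith
    then show "real t \<le> 40 * real s" by linarith
    show "20 * s \<le> t" by (simp add: s_def)
  qed
  have y: "10 \<le> y" using t by (simp add: y_def field_simps)
  have B: "real ?B \<le> y + 1"
  proof -
    have "real ((n - 1) div t) \<le> real (n - 1) / real t" by (rule of_nat_div_le_of_nat)
    also have "\<dots> \<le> y" unfolding y_def by (intro divide_right_mono) auto
    finally show ?thesis using n0 by (simp add: nblocks_def)
  qed
  have b: "y - 1 \<le> real (n div t)"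
  proof -
    have "n \<le> (n div t + 1) * t" using t dividend_less_div_times[of t n] by simp
    then have "real n \<le> (real (n div t) + 1) * real t"
      by (metis of_nat_1 of_nat_add of_nat_le_iff of_nat_mult)
    then show ?thesis using t by (simp add: y_def field_simps)
  qed
  have Bn: "real ?B \<le> real n"
  proof -
    have "(n - 1) div t \<le> n - 1" by (rule div_le_dividend)
    then show ?thesis using n0 by (auto simp: nblocks_def simp del: div_le_dividend)
  qed
  have "(1 + n * z ^ (t - 1)) ^ ?B \<le> 3 / 2"
  proof -
    have "n * z ^ (t - 1) = exp (- 2 * L)" unfolding zt L(1) by (simp flip: exp_add)
    then have "(1 + n * z ^ (t - 1)) ^ ?B \<le> exp (exp (- 2 * L)) ^ ?B"
      by (intro power_mono) (simp_all add: exp_ge_add_one_self)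
    also have "\<dots> = exp (real ?B * exp (- 2 * L))" by (simp add: exp_of_nat_mult)
    also have "\<dots> \<le> exp (real n * exp (- 2 * L))" using Bn by (simp add: mult_right_mono)
    also have "real n * exp (- 2 * L) = exp (- L)" unfolding L(1) by (simp flip: exp_add)
    also have "exp (- L) = 1 / real n" unfolding L(1) by (simp add: exp_minus inverse_eq_divide)
    also have "exp (1 / real n) \<le> 3 / 2"
    proof -
      have x: "1 / real n \<le> 1 / 400" "0 \<le> 1 / real n" using n400 by (simp_all add: field_simps)
      have "exp (1 / real n) \<le> 1 + 1 / real n + (1 / real n)\<^sup>2" by (rule exp_bound) (use x in auto)
      also have "(1 / real n)\<^sup>2 \<le> (1 / 400)\<^sup>2" by (rule power_mono) (use x in auto)
      finally show ?thesis using x by (simp add: power2_eq_square)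
    qed
    finally show ?thesis .
  qed
  from top_fan_in_bound[OF C s(1,2) n0 z this]
  have main: "real n ^ (n div t) * z ^ (?B * (2 * s)) \<le> real (top_fan_in C) * 2 ^ (n div s + 2)" .
  have low: "exp (L * (y / 2)) \<le> real n ^ (n div t) * z ^ (?B * (2 * s))"
  proof -
    \<comment> \<open>Since 20 s is at most t, 2 s is at most t/10, hence at most (t - 1)/9 for t at
      least 10. With the factor 3 in \<open>z\<close>, omitted factors cost a third of the
      exponent.\<close>
    have "real (2 * s) / real (t - 1) \<le> 1 / 9" using s t by (simp add: field_simps)
    then have "3 * L * real ?B * (real (2 * s) / real (t - 1)) \<le> 3 * L * real ?B * (1 / 9)"
      by (intro mult_left_mono) (use L in auto)
    also have "\<dots> \<le> L * ((y + 1) / 3)"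
      using mult_left_mono[OF B, of L] L by (simp add: field_simps)
    finally have 1: "3 * L * real ?B * (real (2 * s) / real (t - 1)) \<le> L * ((y + 1) / 3)" .
    \<comment> \<open>Up to the factor \<open>L\<close> this says that y is at least 8, which t at
      most n/10 guarantees.\<close>
    have "L * (y / 2) + L * ((y + 1) / 3) \<le> L * (y - 1)"
      unfolding distrib_left[symmetric] by (intro mult_left_mono) (use y L in \<open>auto simp: field_simps\<close>)
    also have "\<dots> \<le> L * real (n div t)" using b L by (intro mult_left_mono) auto
    finally have "L * (y / 2) \<le> real (n div t) * L - 3 * L * real ?B * (real (2 * s) / real (t - 1))"
      using 1 by (simp add: mult.commute)
    then have "exp (L * (y / 2)) \<le>
        exp (real (n div t) * L + real (?B * (2 * s)) * (- (3 * L / real (t - 1))))"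
      by (simp add: mult_ac)
    also have "\<dots> = real n ^ (n div t) * z ^ (?B * (2 * s))"
      unfolding z_def L(1) by (simp only: exp_add exp_of_nat_mult)
    finally show ?thesis .
  qed
  have up: "2 ^ (n div s + 2) \<le> exp (L * (y / 4))"
  proof -
    have "(2::real) \<le> exp 1" using exp_ge_add_one_self[of 1] by simp
    then have "(2::real) ^ (n div s + 2) \<le> exp 1 ^ (n div s + 2)" by (intro power_mono) auto
    also have "\<dots> = exp (real (n div s + 2))" by (simp only: exp_of_nat_mult[symmetric] mult_1_right)
    also have "\<dots> \<le> exp (L * (y / 4))"
    proof -
      have "real (n div s) \<le> real n / real s" by (rule of_nat_div_le_of_nat)
      also have "\<dots> \<le> real n / (real t / 40)"
        using s t by (intro divide_left_mono) auto
      also have "\<dots> = 40 * y" by (simp add: y_def)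
      \<comment> \<open>The count is at most 40 y + 2, hence at most 41 y, and 164 = 4 * 41: this is
        the threshold required of ln n.\<close>
      finally have "real (n div s + 2) \<le> 164 * (y / 4)" using y by simp
      also have "\<dots> \<le> L * (y / 4)" using L y by (intro mult_right_mono) auto
      finally show ?thesis by simp
    qed
    finally show ?thesis .
  qed
  \<comment> \<open>Half of \<open>L * y\<close> is gained and at most a quarter is lost to the
    omitted sets. As ln (n^2) is 2 L, the remaining quarter is the constant 1/8.\<close>
  have "exp (L * (y / 4)) * exp (L * (y / 4)) = exp (L * (y / 2))" by (simp flip: exp_add)
  also have "\<dots> \<le> real (top_fan_in C) * 2 ^ (n div s + 2)" using low main by linarith
  also have "\<dots> \<le> real (top_fan_in C) * exp (L * (y / 4))" using up by (intro mult_left_mono) auto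
  finally have "exp (L * (y / 4)) \<le> real (top_fan_in C)" by simp
  moreover have "ln (real (n\<^sup>2)) = 2 * L" using n0 by (simp add: L_def ln_realpow)
  ultimately show ?thesis by (simp add: y_def mult_ac)
qed

theorem theorem2p4:
  shows "\<exists>\<epsilon>::real. \<epsilon> > 0 \<and> (\<exists>c::real. c > 0 \<and> (\<exists>d::nat.
    \<forall>t :: nat \<Rightarrow> nat.
      (\<lambda>n. ln (real n)) \<in> o(\<lambda>n. real (t n)) \<longrightarrow>
      (\<forall>\<^sub>F n in sequentially. real (t n) \<le> \<epsilon> * real n) \<longrightarrow>
      (\<exists>P :: nat \<Rightarrow> 'a::field mpoly.
        explicit_family t P \<and>
        (\<forall>n. total_degree (P n) = n \<and> vars (P n) = {..<n\<^sup>2}) \<and>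
        (\<forall>\<^sub>F n in sequentially.
          (\<exists>C \<in> SigmaPiSigmaPi (t n).
             homogeneous_circuit C \<and> computed C = P n \<and> circuit_size C \<le> n ^ d) \<and>
          (\<forall>t' :: nat. real t' < real (t n) / 20 \<longrightarrow>
             (\<forall>C \<in> SigmaPiSigmaPi t'.
                homogeneous_circuit C \<longrightarrow> computed C = P n \<longrightarrow>
                real (top_fan_in C) \<ge> exp (c * (real n / real (t n) * ln (real (n\<^sup>2))))))))))"
proof (rule exI[of _ "1 / 10"], rule conjI, simp, rule exI[of _ "1 / 8"], rule conjI, simp,
    rule exI[of _ 5], intro allI impI)
  fix t :: "nat \<Rightarrow> nat"
  assume small: "(\<lambda>n. ln (real n)) \<in> o(\<lambda>n. real (t n))"
    and le: "\<forall>\<^sub>F n in sequentially. real (t n) \<le> 1 / 10 * real n"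
  let ?P = "\<lambda>n. band_poly n (t n) :: 'a mpoly"
  \<comment> \<open>Used with ratio 1: eventually t is at least ln n, which exceeds 164, so t is at
    least 40.\<close>
  have 1: "\<forall>\<^sub>F n in sequentially. norm (ln (real n)) \<le> 1 * norm (real (t n))"
    by (rule landau_o.smallD[OF small]) simp
  have "filterlim (\<lambda>n. ln (real n)) at_top sequentially"
    by (rule filterlim_compose[OF ln_at_top filterlim_real_sequentially])
  then have 2: "\<forall>\<^sub>F n in sequentially. 164 \<le> ln (real n)"
    unfolding filterlim_at_top by blast
  have "\<forall>\<^sub>F n in sequentially.
          (\<exists>C \<in> SigmaPiSigmaPi (t n).
             homogeneous_circuit C \<and> computed C = ?P n \<and> circuit_size C \<le> n ^ 5) \<and>
          (\<forall>t' :: nat. real t' < real (t n) / 20 \<longrightarrow>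
             (\<forall>C \<in> SigmaPiSigmaPi t'.
                homogeneous_circuit C \<longrightarrow> computed C = ?P n \<longrightarrow>
                real (top_fan_in C) \<ge> exp (1 / 8 * (real n / real (t n) * ln (real (n\<^sup>2))))))"
    using le 1 2 eventually_ge_at_top[of 2]
  proof eventually_elim
    case (elim n)
    have t: "40 \<le> t n" using elim by simp
    have "\<exists>C \<in> SigmaPiSigmaPi (t n).
        homogeneous_circuit C \<and> computed C = ?P n \<and> circuit_size C \<le> n ^ 5"
      using t elim(4) band_circuit_SigmaPiSigmaPi[of "t n" n] homogeneous_band_circuit
        computed_band_circuit size_band_circuit
      by (intro bexI[of _ "band_circuit n (t n)"] conjI) auto
    then show ?case using band_lower_bound t elim by blast
  qed
  then show "\<exists>P :: nat \<Rightarrow> 'a mpoly.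
        explicit_family t P \<and>
        (\<forall>n. total_degree (P n) = n \<and> vars (P n) = {..<n\<^sup>2}) \<and>
        (\<forall>\<^sub>F n in sequentially.
          (\<exists>C \<in> SigmaPiSigmaPi (t n).
             homogeneous_circuit C \<and> computed C = P n \<and> circuit_size C \<le> n ^ 5) \<and>
          (\<forall>t' :: nat. real t' < real (t n) / 20 \<longrightarrow>
             (\<forall>C \<in> SigmaPiSigmaPi t'.
                homogeneous_circuit C \<longrightarrow> computed C = P n \<longrightarrow>
                real (top_fan_in C) \<ge> exp (1 / 8 * (real n / real (t n) * ln (real (n\<^sup>2)))))))"
    using explicit_band_poly[of t, where 'a = 'a] vars_band_poly
      total_degree_eq[OF keys_band_poly_mons band_poly_nonzero]
    by (intro exI[of _ ?P] conjI allI) auto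
qed

end
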